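(* Let $(G_i,c_i)$, $i\in I$, be circularly-ordered groups, each equipped with a subgroup $H_i\subset G_i$ and an order-preserving isomorphism $\phi_i:(H,d)\to(H_i,c_i)$ from a circularly-ordered group $(H,d)$ (where $H_i$ carries the restriction of $c_i$). The following are equivalent: (1) The free product with amalgamation $*_{i\in I}G_i\,(H_i\stackrel{\phi_i}{\cong}H)$ admits a circular ordering $c$ which extends the ordering $c_i$ of $G_i$ for all $i\in I$. (2) The free product with amalgamation $*_{i\in I}\widetilde G_i\,(\widetilde H_i\stackrel{\widetilde\phi_i}{\cong}\widetilde H)$ admits a left ordering $<$ which extends each of the left orderings $<_{c_i}$ of $\widetilde G_i$, $i\in I$.
   Context: A left ordering of a group $G$ is a strict total ordering $<$ with $g<h\Rightarrow fg<fh$ for all $f,g,h\in G$; its positive cone is $P=\{g\in G: g>id\}$, and $<$ is determined by $P$ via $g<h\iff g^{-1}h\in P$. A circular ordering of a group $G$ is a function $c:G^3\to\{0,\pm1\}$ such that: $c(a_1,a_2,a_3)=0$ if and only if $a_i=a_j$ for some $i\ne j$; $c(a_2,a_3,a_4)-c(a_1,a_3,a_4)+c(a_1,a_2,a_4)-c(a_1,a_2,a_3)=0$ for all $a_1,\dots,a_4\in G$; and $c(ga_1,ga_2,ga_3)=c(a_1,a_2,a_3)$ for all $g,a_1,a_2,a_3\in G$. A pair $(G,c)$ is a circularly-ordered group. A homomorphism $\phi:(G,c)\to(H,d)$ is order-preserving if $c(g_1,g_2,g_3)=d(\phi(g_1),\phi(g_2),\phi(g_3))$ for all $g_1,g_2,g_3\in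 G$. Lift: for a circularly-ordered group $(G,c)$, let $\widetilde G$ be the set $\mathbb{Z}\times G$ with multiplication $(n,a)(m,b)=(n+m+f_c(a,b),ab)$, where $f_c(a,b)=0$ if $a=id$ or $b=id$ or $c(id,a,ab)=1$, and $f_c(a,b)=1$ if $ab=id$ with $a\neq id$, or $c(id,ab,a)=1$. The left ordering $<_c$ of $\widetilde G$ has positive cone $\{(n,a): n\ge0\}\setminus\{(0,id)\}$. $\widetilde G_i$ is the lift of $(G_i,c_i)$, $\widetilde H$ is the lift of $(H,d)$, $\widetilde H_i\subset\widetilde G_i$ is the lift of $(H_i,c_i)$ (as a set, $\mathbb{Z}\times H_i$), and $\widetilde\phi_i:\widetilde H\to\widetilde H_i$ is $\widetilde\phi_i(n,h)=(n,\phi_i(h))$. For groups $G_i$ with subgroups $H_i$ and isomorphisms $\phi_i:H\to H_i$, $*_{i\in I}G_i\,(H_i\stackrel{\phi_i}{\cong}H)$ denotes the free product of the $G_i$ amalgamated by identifying $\phi_i(h)$ with $\phi_j(h)$ for all $h\in H$, $i,j\in I$. Each $G_i$ is regarded as a subgroup of it, and an ordering of the amalgam extends an ordering of $G_i$ if it restricts to it on $G_i$. *)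

theory Defs
  imports "HOL-Algebra.Algebra"
begin

definition left_ordering :: "('a, 'm) monoid_scheme \<Rightarrow> ('a \<Rightarrow> 'a \<Rightarrow> bool) \<Rightarrow> bool" where
  "left_ordering G lt \<longleftrightarrow>
     irreflp_on (carrier G) lt \<and> transp_on (carrier G) lt \<and> totalp_on (carrier G) lt \<and>
     (\<forall>f\<in>carrier G. \<forall>g\<in>carrier G. \<forall>h\<in>carrier G.
        lt g h \<longrightarrow> lt (f \<otimes>\<^bsub>G\<^esub> g) (f \<otimes>\<^bsub>G\<^esub> h))"

definition less_of_cone :: "('a, 'm) monoid_scheme \<Rightarrow> 'a set \<Rightarrow> 'a \<Rightarrow> 'a \<Rightarrow> bool" where
  "less_of_cone G P g h \<longleftrightarrow> inv\<^bsub>G\<^esub> g \<otimes>\<^bsub>G\<^esub> h \<in> P"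

definition circular_ordering ::
    "('a, 'm) monoid_scheme \<Rightarrow> ('a \<Rightarrow> 'a \<Rightarrow> 'a \<Rightarrow> int) \<Rightarrow> bool" where
  "circular_ordering G c \<longleftrightarrow>
     (\<forall>a1\<in>carrier G. \<forall>a2\<in>carrier G. \<forall>a3\<in>carrier G. c a1 a2 a3 \<in> {-1, 0, 1}) \<and>
     (\<forall>a1\<in>carrier G. \<forall>a2\<in>carrier G. \<forall>a3\<in>carrier G.
        c a1 a2 a3 = 0 \<longleftrightarrow> a1 = a2 \<or> a1 = a3 \<or> a2 = a3) \<and>
     (\<forall>a1\<in>carrier G. \<forall>a2\<in>carrier G. \<forall>a3\<in>carrier G. \<forall>a4\<in>carrier G.
        c a2 a3 a4 - c a1 a3 a4 + c a1 a2 a4 - c a1 a2 a3 = 0) \<and>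
     (\<forall>g\<in>carrier G. \<forall>a1\<in>carrier G. \<forall>a2\<in>carrier G. \<forall>a3\<in>carrier G.
        c (g \<otimes>\<^bsub>G\<^esub> a1) (g \<otimes>\<^bsub>G\<^esub> a2) (g \<otimes>\<^bsub>G\<^esub> a3) = c a1 a2 a3)"

definition circular_order_preserving ::
    "('a, 'm) monoid_scheme \<Rightarrow> ('a \<Rightarrow> 'a \<Rightarrow> 'a \<Rightarrow> int) \<Rightarrow> ('b \<Rightarrow> 'b \<Rightarrow> 'b \<Rightarrow> int) \<Rightarrow> ('a \<Rightarrow> 'b) \<Rightarrow> bool"
  where
  "circular_order_preserving G c d \<phi> \<longleftrightarrow>
     (\<forall>g1\<in>carrier G. \<forall>g2\<in>carrier G. \<forall>g3\<in>carrier G.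
        c g1 g2 g3 = d (\<phi> g1) (\<phi> g2) (\<phi> g3))"

definition lift_cocycle ::
    "('a, 'm) monoid_scheme \<Rightarrow> ('a \<Rightarrow> 'a \<Rightarrow> 'a \<Rightarrow> int) \<Rightarrow> 'a \<Rightarrow> 'a \<Rightarrow> int" where
  "lift_cocycle G c a b =
     (if a = \<one>\<^bsub>G\<^esub> \<or> b = \<one>\<^bsub>G\<^esub> \<or> c \<one>\<^bsub>G\<^esub> a (a \<otimes>\<^bsub>G\<^esub> b) = 1 then 0 else 1)"

text \<open>The else-branch above is the usual explicit second clause:\<close>

lemma lift_cocycle_eq_1_iff:
  assumes "group G" "circular_ordering G c" "a \<in> carrier G" "b \<in> carrier G"
  shows "lift_cocycle G c a b = 1 \<longleftrightarrow>
     (a \<otimes>\<^bsub>G\<^esub> b = \<one>\<^bsub>G\<^esub> \<and> a \<noteq> \<one>\<^bsub>G\<^esub>) \<or> c \<one>\<^bsub>G\<^esub> (a \<otimes>\<^bsub>G\<^esub> b) a = 1"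
proof -
  interpret group G by fact
  define x where "x = a \<otimes>\<^bsub>G\<^esub> b"
  have x: "x \<in> carrier G" and e: "\<one>\<^bsub>G\<^esub> \<in> carrier G"
    using assms by (auto simp: x_def)
  have xa: "x = a \<longleftrightarrow> b = \<one>\<^bsub>G\<^esub>"
    using assms by (auto simp: x_def)
  have rng: "c \<one>\<^bsub>G\<^esub> a x \<in> {-1, 0, 1}"
    and zero: "\<And>u v w. u \<in> carrier G \<Longrightarrow> v \<in> carrier G \<Longrightarrow> w \<in> carrier G \<Longrightarrow>
          c u v w = 0 \<longleftrightarrow> u = v \<or> u = w \<or> v = w"
    and coc: "c a x a - c \<one>\<^bsub>G\<^esub> x a + c \<one>\<^bsub>G\<^esub> a a - c \<one>\<^bsub>G\<^esub> a x = 0"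
    using assms x e unfolding circular_ordering_def by blast+
  have asym: "c \<one>\<^bsub>G\<^esub> x a = - c \<one>\<^bsub>G\<^esub> a x"
    using coc zero[of a x a] zero[of "\<one>\<^bsub>G\<^esub>" a a] x e assms by simp
  have b1: "b = \<one>\<^bsub>G\<^esub> \<Longrightarrow> x = a"
    using assms by (simp add: x_def)
  show ?thesis
    using rng zero[of "\<one>\<^bsub>G\<^esub>" a x] asym xa x e assms
    unfolding lift_cocycle_def x_def[symmetric] by (auto split: if_splits)
qed

definition lift_group ::
    "('a, 'm) monoid_scheme \<Rightarrow> ('a \<Rightarrow> 'a \<Rightarrow> 'a \<Rightarrow> int) \<Rightarrow> (int \<times> 'a) monoid" where
  "lift_group G c =
     \<lparr>carrier = UNIV \<times> carrier G,
      monoid.mult = (\<lambda>(n, a) (m, b). (n + m + lift_cocycle G c a b, a \<otimes>\<^bsub>G\<^esub> b)),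
      monoid.one = (0, \<one>\<^bsub>G\<^esub>)\<rparr>"

lemma lift_cocycle_arith:
  fixes p q r s :: int
  assumes "s - q + r - p = 0"
    "p = -1 \<or> p = 0 \<or> p = 1" "q = -1 \<or> q = 0 \<or> q = 1"
    "r = -1 \<or> r = 0 \<or> r = 1" "s = -1 \<or> s = 0 \<or> s = 1"
    "p = 0 \<longleftrightarrow> xe" "q = 0 \<longleftrightarrow> xe \<or> ye" "r = 0 \<longleftrightarrow> ye \<or> ya" "s = 0 \<longleftrightarrow> ya" "\<not> (xe \<and> ye)"
  shows "(if p = 1 then 0 else 1) + (if xe \<or> q = 1 then 0 else 1) =
    (if s = 1 then 0 else 1) + (if ya \<or> r = 1 then 0 else (1::int))"
  using assms(1,10) unfolding assms(6)[symmetric] assms(9)[symmetric]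
  using assms(2-5,7,8) unfolding assms(6)[symmetric] assms(9)[symmetric]
  by (elim disjE) simp_all

lemma group_lift_group:
  assumes "group G" "circular_ordering G c"
  shows "group (lift_group G c)"
proof -
  interpret group G by fact
  let ?f = "lift_cocycle G c"
  let ?e = "\<one>\<^bsub>G\<^esub>"
  have rng: "c u v w = -1 \<or> c u v w = 0 \<or> c u v w = 1"
    if "u \<in> carrier G" "v \<in> carrier G" "w \<in> carrier G" for u v w
    using assms that unfolding circular_ordering_def by blast
  have zero: "c u v w = 0 \<longleftrightarrow> u = v \<or> u = w \<or> v = w"
    if "u \<in> carrier G" "v \<in> carrier G" "w \<in> carrier G" for u v w
    using assms that unfolding circular_ordering_def by blast
  have coc: "c a2 a3 a4 - c a1 a3 a4 + c a1 a2 a4 - c a1 a2 a3 = 0"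
    if "a1 \<in> carrier G" "a2 \<in> carrier G" "a3 \<in> carrier G" "a4 \<in> carrier G" for a1 a2 a3 a4
    using assms that unfolding circular_ordering_def by blast
  have inv: "c (g \<otimes>\<^bsub>G\<^esub> u) (g \<otimes>\<^bsub>G\<^esub> v) (g \<otimes>\<^bsub>G\<^esub> w) = c u v w"
    if "g \<in> carrier G" "u \<in> carrier G" "v \<in> carrier G" "w \<in> carrier G" for g u v w
    using assms that unfolding circular_ordering_def by blast
  have assoc: "?f a b + ?f (a \<otimes>\<^bsub>G\<^esub> b) z = ?f b z + ?f a (b \<otimes>\<^bsub>G\<^esub> z)"
    if a: "a \<in> carrier G" and b: "b \<in> carrier G" and z: "z \<in> carrier G" for a b z
  proof (cases "a = ?e \<or> b = ?e \<or> z = ?e")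
    case True
    then show ?thesis using a b z by (auto simp: lift_cocycle_def)
  next
    case False
    define x where "x = a \<otimes>\<^bsub>G\<^esub> b"
    define y where "y = x \<otimes>\<^bsub>G\<^esub> z"
    define w where "w = b \<otimes>\<^bsub>G\<^esub> z"
    have car: "x \<in> carrier G" "y \<in> carrier G" "w \<in> carrier G" "?e \<in> carrier G"
      using a b z by (simp_all add: x_def y_def w_def)
    have aw: "a \<otimes>\<^bsub>G\<^esub> w = y"
      using a b z by (simp add: x_def y_def w_def m_assoc)
    have ne: "x \<noteq> a" "y \<noteq> x" "w \<noteq> b"
      using a b z False car by (auto simp: x_def y_def w_def)
    have we: "w = ?e \<longleftrightarrow> y = a"
      using aw a car by auto
    have c1: "c a x y = c ?e b w"
      using inv[OF a, of ?e b w] a b car aw by (simp add: x_def)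
    note C = coc[of ?e a x y, OF car(4) a car(1,2)]
    note N = rng[OF car(4) a car(1)] rng[OF car(4) car(1,2)] rng[OF car(4) a car(2)]
      rng[OF a car(1,2)]
    have Z: "c ?e a x = 0 \<longleftrightarrow> x = ?e" "c ?e x y = 0 \<longleftrightarrow> x = ?e \<or> y = ?e"
      "c ?e a y = 0 \<longleftrightarrow> y = ?e \<or> y = a" "c a x y = 0 \<longleftrightarrow> y = a"
      using zero[OF car(4) a car(1)] zero[OF car(4) car(1,2)] zero[OF car(4) a car(2)]
        zero[OF a car(1,2)] ne False by auto
    have F: "?f a b = (if c ?e a x = 1 then 0 else 1)"
      "?f x z = (if x = ?e \<or> c ?e x y = 1 then 0 else 1)"
      "?f b z = (if c a x y = 1 then 0 else 1)"
      "?f a w = (if y = a \<or> c ?e a y = 1 then 0 else 1)"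
      using False we aw c1 by (auto simp: lift_cocycle_def x_def y_def w_def)
    have "?f a b + ?f x z = ?f b z + ?f a w"
      unfolding F using ne(2) by (intro lift_cocycle_arith[OF C N(1-4) Z]) auto
    then show ?thesis by (simp add: x_def w_def)
  qed
  show ?thesis
  proof (rule groupI)
    fix p q r
    assume "p \<in> carrier (lift_group G c)" "q \<in> carrier (lift_group G c)"
      "r \<in> carrier (lift_group G c)"
    then show "p \<otimes>\<^bsub>lift_group G c\<^esub> q \<otimes>\<^bsub>lift_group G c\<^esub> r =
        p \<otimes>\<^bsub>lift_group G c\<^esub> (q \<otimes>\<^bsub>lift_group G c\<^esub> r)"
      using assoc[of "snd p" "snd q" "snd r"]
      by (auto simp: lift_group_def split: prod.splits intro: m_assoc)
  next
    fix p assume p: "p \<in> carrier (lift_group G c)"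
    obtain n a where na: "p = (n, a)" "a \<in> carrier G"
      using p by (auto simp: lift_group_def)
    show "\<exists>q\<in>carrier (lift_group G c). q \<otimes>\<^bsub>lift_group G c\<^esub> p = \<one>\<^bsub>lift_group G c\<^esub>"
      using na by (intro bexI[of _ "(- n - ?f (inv\<^bsub>G\<^esub> a) a, inv\<^bsub>G\<^esub> a)"])
        (auto simp: lift_group_def)
  qed (auto simp: lift_group_def lift_cocycle_def)
qed

definition lift_cone :: "('a, 'm) monoid_scheme \<Rightarrow> (int \<times> 'a) set" where
  "lift_cone G = {(n, a). n \<ge> 0 \<and> a \<in> carrier G} - {(0, \<one>\<^bsub>G\<^esub>)}"

definition lift_less ::
    "('a, 'm) monoid_scheme \<Rightarrow> ('a \<Rightarrow> 'a \<Rightarrow> 'a \<Rightarrow> int) \<Rightarrow> int \<times> 'a \<Rightarrow> int \<times> 'a \<Rightarrow> bool" where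
  "lift_less G c = less_of_cone (lift_group G c) (lift_cone G)"

definition lift_map :: "('a \<Rightarrow> 'b) \<Rightarrow> int \<times> 'a \<Rightarrow> int \<times> 'b" where
  "lift_map \<phi> = (\<lambda>(n, h). (n, \<phi> h))"

text \<open>
  The amalgam is presented as the monoid of words in the letters \<open>(i, x)\<close> with \<open>i \<in> I\<close> and
  \<open>x \<in> G\<^sub>i\<close>, modulo the congruence generated by the multiplication tables of the \<open>G\<^sub>i\<close> and the
  identifications of \<open>\<phi>\<^sub>i h\<close> with \<open>\<phi>\<^sub>j h\<close>. Formal inverses of letters are not needed, since
  \<open>(i, x)\<close> and \<open>(i, x\<inverse>)\<close> become mutually inverse.
\<close>

definition amalgam_words :: "'i set \<Rightarrow> ('i \<Rightarrow> ('a, 'm) monoid_scheme) \<Rightarrow> ('i \<times> 'a) list set" where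
  "amalgam_words I G = lists (SIGMA i:I. carrier (G i))"

inductive amalgam_eq ::
    "'i set \<Rightarrow> ('i \<Rightarrow> ('a, 'm) monoid_scheme) \<Rightarrow> ('b, 'n) monoid_scheme \<Rightarrow> ('i \<Rightarrow> 'b \<Rightarrow> 'a) \<Rightarrow>
     ('i \<times> 'a) list \<Rightarrow> ('i \<times> 'a) list \<Rightarrow> bool"
  for I G H \<phi>
where
  refl: "w \<in> amalgam_words I G \<Longrightarrow> amalgam_eq I G H \<phi> w w"
| sym: "amalgam_eq I G H \<phi> u v \<Longrightarrow> amalgam_eq I G H \<phi> v u"
| trans: "amalgam_eq I G H \<phi> u v \<Longrightarrow> amalgam_eq I G H \<phi> v w \<Longrightarrow> amalgam_eq I G H \<phi> u w"
| append: "amalgam_eq I G H \<phi> u u' \<Longrightarrow> amalgam_eq I G H \<phi> v v' \<Longrightarrow>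
     amalgam_eq I G H \<phi> (u @ v) (u' @ v')"
| mult: "i \<in> I \<Longrightarrow> x \<in> carrier (G i) \<Longrightarrow> y \<in> carrier (G i) \<Longrightarrow>
     amalgam_eq I G H \<phi> [(i, x), (i, y)] [(i, x \<otimes>\<^bsub>G i\<^esub> y)]"
| one: "i \<in> I \<Longrightarrow> amalgam_eq I G H \<phi> [(i, \<one>\<^bsub>G i\<^esub>)] []"
| glue: "i \<in> I \<Longrightarrow> j \<in> I \<Longrightarrow> h \<in> carrier H \<Longrightarrow>
     amalgam_eq I G H \<phi> [(i, \<phi> i h)] [(j, \<phi> j h)]"

definition amalgam_rel ::
    "'i set \<Rightarrow> ('i \<Rightarrow> ('a, 'm) monoid_scheme) \<Rightarrow> ('b, 'n) monoid_scheme \<Rightarrow> ('i \<Rightarrow> 'b \<Rightarrow> 'a) \<Rightarrow>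
     ('i \<times> 'a) list rel" where
  "amalgam_rel I G H \<phi> = {(u, v). amalgam_eq I G H \<phi> u v}"

definition amalgam ::
    "'i set \<Rightarrow> ('i \<Rightarrow> ('a, 'm) monoid_scheme) \<Rightarrow> ('b, 'n) monoid_scheme \<Rightarrow> ('i \<Rightarrow> 'b \<Rightarrow> 'a) \<Rightarrow>
     ('i \<times> 'a) list set monoid" where
  "amalgam I G H \<phi> =
     \<lparr>carrier = amalgam_words I G // amalgam_rel I G H \<phi>,
      monoid.mult = (\<lambda>A B. \<Union>u\<in>A. \<Union>v\<in>B. amalgam_rel I G H \<phi> `` {u @ v}),
      monoid.one = amalgam_rel I G H \<phi> `` {[]}\<rparr>"

definition amalgam_incl ::
    "'i set \<Rightarrow> ('i \<Rightarrow> ('a, 'm) monoid_scheme) \<Rightarrow> ('b, 'n) monoid_scheme \<Rightarrow> ('i \<Rightarrow> 'b \<Rightarrow> 'a) \<Rightarrow>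
     'i \<Rightarrow> 'a \<Rightarrow> ('i \<times> 'a) list set" where
  "amalgam_incl I G H \<phi> i x = amalgam_rel I G H \<phi> `` {[(i, x)]}"

locale amalgam_data =
  fixes I :: "'i set" and G :: "'i \<Rightarrow> ('a, 'm) monoid_scheme"
    and H :: "('b, 'n) monoid_scheme" and \<phi> :: "'i \<Rightarrow> 'b \<Rightarrow> 'a"
  assumes group_G: "i \<in> I \<Longrightarrow> group (G i)"
    and group_H: "group H"
    and hom_\<phi>: "i \<in> I \<Longrightarrow> \<phi> i \<in> hom H (G i)"
begin

abbreviation "W \<equiv> amalgam_words I G"
abbreviation "R \<equiv> amalgam_rel I G H \<phi>"
abbreviation "K \<equiv> amalgam I G H \<phi>"

lemma append_in_words [simp]: "u @ v \<in> W \<longleftrightarrow> u \<in> W \<and> v \<in> W"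
  by (auto simp: amalgam_words_def)

lemma Nil_in_words [simp]: "[] \<in> W"
  by (auto simp: amalgam_words_def)

lemma amalgam_eq_words: "amalgam_eq I G H \<phi> u v \<Longrightarrow> u \<in> W \<and> v \<in> W"
proof (induction rule: amalgam_eq.induct)
  case (mult i x y)
  then interpret group "G i" using group_G by blast
  from mult show ?case by (auto simp: amalgam_words_def)
next
  case (one i)
  then interpret group "G i" using group_G by blast
  from one show ?case by (auto simp: amalgam_words_def)
next
  case (glue i j h)
  then show ?case using hom_\<phi> by (auto simp: amalgam_words_def hom_def)
qed auto

lemma equiv_amalgam_rel: "equiv W R"
proof (rule equivI)
  show "R \<subseteq> W \<times> W" using amalgam_eq_words by (auto simp: amalgam_rel_def)
  show "refl_on W R" by (auto simp: refl_on_def amalgam_rel_def intro: amalgam_eq.refl)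
  show "Relation.sym R" by (auto simp: sym_def amalgam_rel_def intro: amalgam_eq.sym)
  show "Relation.trans R" by (auto simp: trans_def amalgam_rel_def intro: amalgam_eq.trans)
qed

lemma amalgam_mult_class:
  assumes "u \<in> W" "v \<in> W"
  shows "R `` {u} \<otimes>\<^bsub>K\<^esub> R `` {v} = R `` {u @ v}"
proof -
  have "congruent2 R R (\<lambda>u v. R `` {u @ v})"
    by (rule congruent2I', rule equiv_class_eq[OF equiv_amalgam_rel])
       (auto simp: amalgam_rel_def intro: amalgam_eq.append)
  from UN_equiv_class2[OF equiv_amalgam_rel equiv_amalgam_rel this assms]
  show ?thesis by (simp add: amalgam_def)
qed

lemma amalgam_inverse:
  assumes "w \<in> W"
  shows "\<exists>v\<in>W. (v @ w, []) \<in> R"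
  using assms
proof (induction w)
  case Nil
  then show ?case by (auto simp: amalgam_rel_def intro!: bexI[of _ "[]"] amalgam_eq.refl)
next
  case (Cons l w)
  obtain i x where l: "l = (i, x)" by (cases l)
  from Cons.prems have i: "i \<in> I" and x: "x \<in> carrier (G i)" and w: "w \<in> W"
    by (auto simp: l amalgam_words_def)
  interpret group "G i" using group_G i by blast
  from Cons.IH[OF w] obtain v where v: "v \<in> W" "amalgam_eq I G H \<phi> (v @ w) []"
    by (auto simp: amalgam_rel_def)
  let ?y = "inv\<^bsub>G i\<^esub> x"
  have "amalgam_eq I G H \<phi> [(i, ?y), (i, x)] [(i, ?y \<otimes>\<^bsub>G i\<^esub> x)]"
    using i x by (intro amalgam_eq.mult) auto
  moreover have "amalgam_eq I G H \<phi> [(i, ?y \<otimes>\<^bsub>G i\<^esub> x)] []"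
    using i x amalgam_eq.one[of i I G H \<phi>] by simp
  ultimately have "amalgam_eq I G H \<phi> [(i, ?y), (i, x)] []"
    by (rule amalgam_eq.trans)
  then have "amalgam_eq I G H \<phi> (v @ [(i, ?y), (i, x)] @ w) (v @ [] @ w)"
    using v w by (intro amalgam_eq.append amalgam_eq.refl)
  with v have "amalgam_eq I G H \<phi> (v @ [(i, ?y), (i, x)] @ w) []"
    by (auto intro: amalgam_eq.trans)
  moreover have "[(i, ?y)] \<in> W" using i x by (auto simp: amalgam_words_def)
  ultimately show ?case using v
    by (auto simp: l amalgam_rel_def intro!: bexI[of _ "v @ [(i, ?y)]"])
qed

lemma group_amalgam: "group K"
proof (rule groupI)
  have car: "carrier K = W // R" and one: "\<one>\<^bsub>K\<^esub> = R `` {[]}"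
    by (simp_all add: amalgam_def)
  show "\<one>\<^bsub>K\<^esub> \<in> carrier K"
    by (auto simp: car one intro: quotientI)
  fix A assume "A \<in> carrier K"
  then obtain a where a: "a \<in> W" "A = R `` {a}" by (auto simp: car elim: quotientE)
  show "\<one>\<^bsub>K\<^esub> \<otimes>\<^bsub>K\<^esub> A = A"
    using a by (simp add: one amalgam_mult_class)
  from amalgam_inverse[OF a(1)] obtain v where v: "v \<in> W" "(v @ a, []) \<in> R" by blast
  have "R `` {v} \<otimes>\<^bsub>K\<^esub> A = \<one>\<^bsub>K\<^esub>"
    using a v by (simp add: one amalgam_mult_class equiv_class_eq[OF equiv_amalgam_rel])
  then show "\<exists>B\<in>carrier K. B \<otimes>\<^bsub>K\<^esub> A = \<one>\<^bsub>K\<^esub>"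
    using v by (auto simp: car intro: quotientI)
  fix B assume "B \<in> carrier K"
  then obtain b where b: "b \<in> W" "B = R `` {b}" by (auto simp: car elim: quotientE)
  show "A \<otimes>\<^bsub>K\<^esub> B \<in> carrier K"
    using a b by (simp add: car amalgam_mult_class quotientI)
  fix C assume "C \<in> carrier K"
  then obtain c where c: "c \<in> W" "C = R `` {c}" by (auto simp: car elim: quotientE)
  show "A \<otimes>\<^bsub>K\<^esub> B \<otimes>\<^bsub>K\<^esub> C = A \<otimes>\<^bsub>K\<^esub> (B \<otimes>\<^bsub>K\<^esub> C)"
    using a b c by (simp add: amalgam_mult_class)
qed

lemma amalgam_incl_hom: "i \<in> I \<Longrightarrow> amalgam_incl I G H \<phi> i \<in> hom (G i) K"
proof -
  assume i: "i \<in> I"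
  then interpret group "G i" using group_G by blast
  have W: "[(i, x)] \<in> W" if "x \<in> carrier (G i)" for x
    using that i by (auto simp: amalgam_words_def)
  have "R `` {[(i, x \<otimes>\<^bsub>G i\<^esub> y)]} = R `` {[(i, x)]} \<otimes>\<^bsub>K\<^esub> R `` {[(i, y)]}"
    if "x \<in> carrier (G i)" "y \<in> carrier (G i)" for x y
  proof -
    have "([(i, x), (i, y)], [(i, x \<otimes>\<^bsub>G i\<^esub> y)]) \<in> R"
      using i that by (auto simp: amalgam_rel_def intro: amalgam_eq.mult)
    with that W show ?thesis
      by (simp add: amalgam_mult_class equiv_class_eq[OF equiv_amalgam_rel])
  qed
  then show ?thesis
    using W by (auto simp: hom_def amalgam_incl_def amalgam_def intro!: quotientI)
qed

lemma amalgam_incl_glue: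
  assumes "i \<in> I" "j \<in> I" "h \<in> carrier H"
  shows "amalgam_incl I G H \<phi> i (\<phi> i h) = amalgam_incl I G H \<phi> j (\<phi> j h)"
  unfolding amalgam_incl_def using assms
  by (intro equiv_class_eq[OF equiv_amalgam_rel]) (auto simp: amalgam_rel_def intro: amalgam_eq.glue)

end

end

theory Submission
  imports Defs
begin

text \<open>
  Write \<open>K\<close> for the amalgam of the \<open>G\<^sub>i\<close> and \<open>K'\<close> for the amalgam of their lifts. The elements \<open>(n, 1)\<close>
  of the lifts are all glued together in \<open>K'\<close> and form a central copy \<open>\<zeta>\<close> of the integers. The key fact
  is that \<open>K'\<close> is a central extension of \<open>K\<close> by this copy: forgetting the integer coordinate
  induces a surjection \<open>\<pi> : K' \<rightarrow> K\<close> whose kernel is the range of \<open>\<zeta>\<close>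
  (\<open>projection\<close>). By the universal property the maps \<open>x \<mapsto> [(0, x)]\<close> induce
  \<open>\<theta> : K \<rightarrow> K' / \<zeta>(\<int>)\<close>, and \<open>\<theta> \<circ> \<pi>\<close> agrees with the quotient map on generators, so an element of the kernel
  of \<open>\<pi>\<close> is trivial modulo \<open>\<zeta>(\<int>)\<close>.

  Suppose that \<open>K\<close> carries a circular ordering \<open>C\<close> extending the given ones. The inclusions \<open>G\<^sub>i \<rightarrow> K\<close> lift to the
  lifted groups and induce a homomorphism \<open>\<psi>\<close> from \<open>K'\<close> to the lift of \<open>(K, C)\<close>, lying over \<open>\<pi>\<close>. Its kernel
  therefore consists of elements \<open>\<zeta> n\<close>, and \<open>\<psi> (\<zeta> n) = (n, 1)\<close>, so \<open>\<psi>\<close> is injective. The left ordering of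
  the lift of \<open>(K, C)\<close> pulls back along \<open>\<psi>\<close> to the desired left ordering of \<open>K'\<close>
  (\<open>left_ordering_of_circular_ordering\<close>).

  Conversely, let \<open>K'\<close> carry a left ordering extending those of the lifts. Every element of \<open>K'\<close> is a translate by
  some \<open>\<zeta> n\<close> of an element of the interval from \<open>1\<close> to \<open>\<zeta> 1\<close>, because this holds for the
  generators and is stable under products. So \<open>\<pi>\<close> maps this interval bijectively onto \<open>K\<close>, and a triple
  in \<open>K\<close> is oriented by the permutation that sorts its representatives (\<open>circular_ordering_induced\<close>). The class
  of \<open>x \<in> G\<^sub>i\<close> is represented by \<open>(0, x)\<close>, and on these representatives the left ordering of the lift gives back
  \<open>c\<^sub>i\<close> (\<open>orientation_lift\<close>), so the circular ordering extends each \<open>c\<^sub>i\<close>.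
\<close>

section \<open>Generation and universal property of amalgams\<close>

context amalgam_data
begin

lemma incl_carrier: "i \<in> I \<Longrightarrow> x \<in> carrier (G i) \<Longrightarrow> amalgam_incl I G H \<phi> i x \<in> carrier K"
  using amalgam_incl_hom by (auto simp: hom_def)

text \<open>
  The amalgam is generated by the images of the \<open>G\<^sub>i\<close>; a letter at a time suffices since the \<open>G\<^sub>i\<close> are closed
  under inverses.
\<close>

lemma amalgam_induct [consumes 1, case_names one incl_mult]:
  assumes A: "A \<in> carrier K"
    and one: "P \<one>\<^bsub>K\<^esub>"
    and mult: "\<And>i x B. i \<in> I \<Longrightarrow> x \<in> carrier (G i) \<Longrightarrow> B \<in> carrier K \<Longrightarrow> P B \<Longrightarrow>
      P (amalgam_incl I G H \<phi> i x \<otimes>\<^bsub>K\<^esub> B)"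
  shows "P A"
proof -
  obtain w where w: "w \<in> W" "A = R `` {w}"
    using A by (auto simp: amalgam_def elim: quotientE)
  have "P (R `` {w})" using w(1)
  proof (induction w)
    case Nil
    then show ?case using one by (simp add: amalgam_def)
  next
    case (Cons l w)
    obtain i x where l: "l = (i, x)" by (cases l)
    have i: "i \<in> I" "x \<in> carrier (G i)" "w \<in> W" "[(i, x)] \<in> W"
      using Cons.prems by (auto simp: l amalgam_words_def)
    have "R `` {w} \<in> carrier K" using i by (simp add: amalgam_def quotientI)
    from mult[OF i(1,2) this] have "P (R `` {[(i, x)]} \<otimes>\<^bsub>K\<^esub> R `` {w})"
      using Cons.IH i by (simp add: amalgam_incl_def)
    then show ?case using i by (simp add: amalgam_mult_class l)
  qed
  then show ?thesis using w by simp
qed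

lemma amalgam_hom_unique:
  assumes "group L" "F \<in> hom K L" "F' \<in> hom K L"
    and agree: "\<And>i x. i \<in> I \<Longrightarrow> x \<in> carrier (G i) \<Longrightarrow>
      F (amalgam_incl I G H \<phi> i x) = F' (amalgam_incl I G H \<phi> i x)"
    and A: "A \<in> carrier K"
  shows "F A = F' A"
proof -
  interpret F: group_hom K L F
    using assms group_amalgam by (simp add: group_hom_def group_hom_axioms_def)
  interpret F': group_hom K L F'
    using assms group_amalgam by (simp add: group_hom_def group_hom_axioms_def)
  show ?thesis using A
    by (induction A rule: amalgam_induct) (simp_all add: incl_carrier agree)
qed

text \<open>
  A word is evaluated letter by letter in the target group. Each generating relation of the amalgam holds there, so
  equivalent words have the same value.
\<close>

lemma amalgam_universal:
  assumes L: "group L"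
    and f: "\<And>i. i \<in> I \<Longrightarrow> f i \<in> hom (G i) L"
    and compat: "\<And>i j h. i \<in> I \<Longrightarrow> j \<in> I \<Longrightarrow> h \<in> carrier H \<Longrightarrow> f i (\<phi> i h) = f j (\<phi> j h)"
  obtains F where "F \<in> hom K L"
    and "\<And>i x. i \<in> I \<Longrightarrow> x \<in> carrier (G i) \<Longrightarrow> F (amalgam_incl I G H \<phi> i x) = f i x"
proof -
  interpret L: group L by fact
  define ev where "ev w = foldr (\<lambda>(i, x) y. f i x \<otimes>\<^bsub>L\<^esub> y) w \<one>\<^bsub>L\<^esub>" for w
  have fc: "f i x \<in> carrier L" if "i \<in> I" "x \<in> carrier (G i)" for i x
    using f that by (auto simp: hom_def)
  have ev_simps: "ev [] = \<one>\<^bsub>L\<^esub>" "ev ((i, x) # w) = f i x \<otimes>\<^bsub>L\<^esub> ev w" for i x w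
    by (simp_all add: ev_def)
  have evc: "ev w \<in> carrier L" if "w \<in> W" for w
    using that by (induction w) (auto simp: ev_simps amalgam_words_def fc)
  have ev_append: "ev (u @ v) = ev u \<otimes>\<^bsub>L\<^esub> ev v" if "u \<in> W" "v \<in> W" for u v
    using that(1)
  proof (induction u)
    case Nil
    then show ?case using evc that by (simp add: ev_simps)
  next
    case (Cons l u)
    then have "u \<in> W" "fst l \<in> I" "snd l \<in> carrier (G (fst l))" by (auto simp: amalgam_words_def)
    then show ?case using Cons.IH that evc
      by (cases l) (simp add: ev_simps fc L.m_assoc)
  qed
  have ev_eq: "ev u = ev v" if "amalgam_eq I G H \<phi> u v" for u v
    using that
  proof (induction rule: amalgam_eq.induct)
    case (append u u' v v')
    then show ?case using amalgam_eq_words by (metis ev_append)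
  next
    case (mult i x y)
    then interpret Gi: group "G i" using group_G by blast
    show ?case using mult fc by (simp add: ev_simps hom_mult[OF f])
  next
    case (one i)
    then show ?case using hom_one[OF f group_G L] by (simp add: ev_simps)
  next
    case (glue i j h)
    then have "\<phi> i h \<in> carrier (G i)" "\<phi> j h \<in> carrier (G j)"
      using hom_\<phi> by (auto simp: hom_def)
    then show ?case using glue fc compat[of i j h] by (simp add: ev_simps)
  qed auto
  define F where "F A = ev (SOME w. w \<in> A)" for A
  have F_class: "F (R `` {w}) = ev w" if "w \<in> W" for w
  proof -
    have "w \<in> R `` {w}" using that by (auto simp: amalgam_rel_def intro: amalgam_eq.refl)
    then have "(SOME v. v \<in> R `` {w}) \<in> R `` {w}" by (rule someI)
    then show ?thesis unfolding F_def using ev_eq by (auto simp: amalgam_rel_def)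
  qed
  have "F \<in> hom K L"
  proof (rule homI)
    fix A assume "A \<in> carrier K"
    then obtain a where a: "a \<in> W" "A = R `` {a}" by (auto simp: amalgam_def elim: quotientE)
    then show "F A \<in> carrier L" using F_class evc by simp
    fix B assume "B \<in> carrier K"
    then obtain b where b: "b \<in> W" "B = R `` {b}" by (auto simp: amalgam_def elim: quotientE)
    show "F (A \<otimes>\<^bsub>K\<^esub> B) = F A \<otimes>\<^bsub>L\<^esub> F B"
      using a b by (simp add: amalgam_mult_class F_class ev_append)
  qed
  moreover have "F (amalgam_incl I G H \<phi> i x) = f i x" if "i \<in> I" "x \<in> carrier (G i)" for i x
  proof -
    have "[(i, x)] \<in> W" using that by (auto simp: amalgam_words_def)
    then show ?thesis using that by (simp add: amalgam_incl_def F_class ev_simps fc)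
  qed
  ultimately show thesis using that by blast
qed

end

section \<open>Orientation of triples in a linear ordering\<close>

lemma left_ordering_of_cone:
  fixes G (structure)
  assumes "group G"
    and P: "P \<subseteq> carrier G" "\<one>\<^bsub>G\<^esub> \<notin> P"
    and mult: "\<And>a b. a \<in> P \<Longrightarrow> b \<in> P \<Longrightarrow> a \<otimes>\<^bsub>G\<^esub> b \<in> P"
    and total: "\<And>a. a \<in> carrier G \<Longrightarrow> a \<noteq> \<one>\<^bsub>G\<^esub> \<Longrightarrow> a \<in> P \<or> inv\<^bsub>G\<^esub> a \<in> P"
  shows "left_ordering G (less_of_cone G P)"
proof -
  interpret group G by fact
  have cancel: "inv a \<otimes> (a \<otimes> b) = b" if "a \<in> carrier G" "b \<in> carrier G" for a b
    using that by (simp add: m_assoc[symmetric])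
  have tr: "(inv a \<otimes> b) \<otimes> (inv b \<otimes> x) = inv a \<otimes> x"
    if "a \<in> carrier G" "b \<in> carrier G" "x \<in> carrier G" for a b x
    using that cancel[of "inv b" x] by (simp add: m_assoc)
  have tot: "inv a \<otimes> b \<in> P \<or> inv b \<otimes> a \<in> P"
    if "a \<in> carrier G" "b \<in> carrier G" "a \<noteq> b" for a b
  proof -
    have "inv a \<otimes> b \<noteq> \<one>" using that by (metis inv_closed inv_equality inv_inv)
    moreover have "inv (inv a \<otimes> b) = inv b \<otimes> a" using that by (simp add: inv_mult_group)
    ultimately show ?thesis using total[of "inv a \<otimes> b"] that by auto
  qed
  have left: "inv (f \<otimes> a) \<otimes> (f \<otimes> b) = inv a \<otimes> b"
    if "f \<in> carrier G" "a \<in> carrier G" "b \<in> carrier G" for f a b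
    using that cancel[of f b] by (simp add: inv_mult_group m_assoc)
  show ?thesis
    unfolding left_ordering_def less_of_cone_def
  proof (intro conjI)
    show "irreflp_on (carrier G) (\<lambda>g h. inv g \<otimes> h \<in> P)"
      using P by (auto simp: irreflp_on_def)
    show "transp_on (carrier G) (\<lambda>g h. inv g \<otimes> h \<in> P)"
      unfolding transp_on_def using mult tr by metis
    show "totalp_on (carrier G) (\<lambda>g h. inv g \<otimes> h \<in> P)"
      using tot by (auto simp: totalp_on_def)
  qed (simp add: left)
qed

definition order_sign :: "('a \<Rightarrow> 'a \<Rightarrow> bool) \<Rightarrow> 'a \<Rightarrow> 'a \<Rightarrow> int" where
  "order_sign lt x y = (if lt x y then 1 else if lt y x then -1 else 0)"

text \<open>
  The sign of the permutation that sorts the triple, written as the coboundary of the sign of a pair. In this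
  form the cocycle identity is immediate, and two sign functions that differ by a coboundary
  \<open>u(y) - u(x)\<close> give the same orientation; this is used for left invariance and for comparison with
  the circular ordering in a lift.
\<close>

definition orientation :: "('a \<Rightarrow> 'a \<Rightarrow> bool) \<Rightarrow> 'a \<Rightarrow> 'a \<Rightarrow> 'a \<Rightarrow> int" where
  "orientation lt x y w = order_sign lt y w - order_sign lt x w + order_sign lt x y"

lemma orientation_range:
  assumes "irreflp_on S lt" "transp_on S lt" "totalp_on S lt" "x \<in> S" "y \<in> S" "w \<in> S"
  shows "orientation lt x y w \<in> {-1, 0, 1}"
    and "orientation lt x y w = 0 \<longleftrightarrow> x = y \<or> x = w \<or> y = w"
proof -
  have tr: "lt a b \<Longrightarrow> lt b c \<Longrightarrow> lt a c" if "a \<in> S" "b \<in> S" "c \<in> S" for a b c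
    using assms(2) that unfolding transp_on_def by blast
  have ir: "\<not> lt a a" if "a \<in> S" for a
    using assms(1) that unfolding irreflp_on_def by blast
  have to: "a \<noteq> b \<Longrightarrow> lt a b \<or> lt b a" if "a \<in> S" "b \<in> S" for a b
    using assms(3) that unfolding totalp_on_def by blast
  have sgn: "order_sign lt a b = (if a = b then 0 else if lt a b then 1 else -1)"
    if "a \<in> S" "b \<in> S" for a b
    using that ir to by (auto simp: order_sign_def)
  have 1: "lt x y \<Longrightarrow> lt y w \<Longrightarrow> lt x w" using tr assms(4-6) by blast
  have 2: "\<not> lt x y \<Longrightarrow> \<not> lt y w \<Longrightarrow> x \<noteq> y \<Longrightarrow> y \<noteq> w \<Longrightarrow> \<not> lt x w"
    using tr ir to assms(4-6) by blast
  have "orientation lt x y w \<in> {-1, 0, 1} \<and> (orientation lt x y w = 0 \<longleftrightarrow> x = y \<or> x = w \<or> y = w)"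
  proof (cases "x = y \<or> x = w \<or> y = w")
    case True
    then show ?thesis using to[of x y] tr[of x y x] ir[of x] ir[of y] ir[of w] assms(4-6)
      by (elim disjE) (auto simp: orientation_def order_sign_def)
  next
    case False
    then show ?thesis using 1 2 assms(4-6) by (auto simp: orientation_def sgn)
  qed
  then show "orientation lt x y w \<in> {-1, 0, 1}"
    "orientation lt x y w = 0 \<longleftrightarrow> x = y \<or> x = w \<or> y = w" by blast+
qed

section \<open>Quotients of left-ordered groups by central cofinal integers\<close>

locale positive_central_integers = group E
  for E :: "('e, 'm) monoid_scheme" (structure) +
  fixes \<zeta> :: "int \<Rightarrow> 'e" and lt :: "'e \<Rightarrow> 'e \<Rightarrow> bool"
  assumes lo: "left_ordering E lt"
    and zeta_hom: "\<zeta> \<in> hom integer_group E"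
    and central: "g \<in> carrier E \<Longrightarrow> g \<otimes> \<zeta> n = \<zeta> n \<otimes> g"
    and zeta_pos: "lt \<one> (\<zeta> 1)"
begin

definition unit_interval :: "'e set" where
  "unit_interval = {r \<in> carrier E. \<not> lt r \<one> \<and> lt r (\<zeta> 1)}"

lemma zeta_carrier [simp]: "\<zeta> n \<in> carrier E"
  using zeta_hom by (auto simp: hom_def)

lemma zeta_add: "\<zeta> (n + m) = \<zeta> n \<otimes> \<zeta> m"
  using zeta_hom by (auto simp: hom_def)

lemma zeta_0 [simp]: "\<zeta> 0 = \<one>"
  using zeta_add[of 0 0] by (metis add.right_neutral r_cancel_one' zeta_carrier)

lemma unit_interval_carrier: "r \<in> unit_interval \<Longrightarrow> r \<in> carrier E"
  by (simp add: unit_interval_def)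

lemma lt_irrefl: "a \<in> carrier E \<Longrightarrow> \<not> lt a a"
  using lo unfolding left_ordering_def irreflp_on_def by blast

lemma lt_trans:
  "lt a b \<Longrightarrow> lt b c \<Longrightarrow> a \<in> carrier E \<Longrightarrow> b \<in> carrier E \<Longrightarrow> c \<in> carrier E \<Longrightarrow> lt a c"
  using lo unfolding left_ordering_def transp_on_def by blast

lemma lt_total: "a \<in> carrier E \<Longrightarrow> b \<in> carrier E \<Longrightarrow> a \<noteq> b \<Longrightarrow> lt a b \<or> lt b a"
  using lo unfolding left_ordering_def totalp_on_def by blast

lemma lt_left_iff:
  assumes "f \<in> carrier E" "a \<in> carrier E" "b \<in> carrier E"
  shows "lt (f \<otimes> a) (f \<otimes> b) \<longleftrightarrow> lt a b"
proof
  have l: "lt u v \<Longrightarrow> lt (g \<otimes> u) (g \<otimes> v)"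
    if "g \<in> carrier E" "u \<in> carrier E" "v \<in> carrier E" for g u v
    using lo that unfolding left_ordering_def by blast
  show "lt a b \<Longrightarrow> lt (f \<otimes> a) (f \<otimes> b)" using l assms by blast
  assume "lt (f \<otimes> a) (f \<otimes> b)"
  then have "lt (inv f \<otimes> (f \<otimes> a)) (inv f \<otimes> (f \<otimes> b))" using l assms by simp
  then show "lt a b" using assms by (simp add: m_assoc[symmetric])
qed

lemma zeta_ge: "n \<ge> 1 \<Longrightarrow> \<not> lt (\<zeta> n) (\<zeta> 1)"
proof (induction n rule: int_ge_induct)
  case base
  then show ?case by (simp add: lt_irrefl)
next
  case (step n)
  have "lt (\<zeta> n \<otimes> \<one>) (\<zeta> n \<otimes> \<zeta> 1)" using zeta_pos by (subst lt_left_iff) auto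
  then have "lt (\<zeta> n) (\<zeta> (n + 1))" by (simp add: zeta_add)
  then show ?case using step.IH lt_trans zeta_carrier by blast
qed

text \<open>
  Distinct translates of the interval by central integers are disjoint: \<open>1 \<le> r\<close> forces \<open>\<zeta> 1 \<le> \<zeta> n \<le> \<zeta> n r\<close>.
\<close>

lemma translate_notin_unit_interval:
  assumes "r \<in> unit_interval" "n \<ge> 1" shows "\<zeta> n \<otimes> r \<notin> unit_interval"
proof
  assume "\<zeta> n \<otimes> r \<in> unit_interval"
  then have 1: "lt (\<zeta> n \<otimes> r) (\<zeta> 1)" by (simp add: unit_interval_def)
  have r: "r \<in> carrier E" "r = \<one> \<or> lt \<one> r" using assms lt_total by (auto simp: unit_interval_def)
  from r(2) have "\<zeta> n \<otimes> r = \<zeta> n \<or> lt (\<zeta> n \<otimes> \<one>) (\<zeta> n \<otimes> r)"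
    using r(1) by (subst lt_left_iff) auto
  then have "lt (\<zeta> n) (\<zeta> 1)"
    using 1 r lt_trans[of "\<zeta> n" "\<zeta> n \<otimes> r" "\<zeta> 1"] by auto
  then show False using zeta_ge assms by blast
qed

lemma order_sign_left:
  "f \<in> carrier E \<Longrightarrow> a \<in> carrier E \<Longrightarrow> b \<in> carrier E \<Longrightarrow>
    order_sign lt (f \<otimes> a) (f \<otimes> b) = order_sign lt a b"
  by (simp add: order_sign_def lt_left_iff)

text \<open>
  The product of two elements of the interval lies between \<open>1\<close> and \<open>\<zeta> 2\<close>, so it has to be translated back
  by \<open>0\<close> or \<open>1\<close>, as for the carry in the addition of digits.
\<close>

definition carry :: "'e \<Rightarrow> 'e \<Rightarrow> int" where
  "carry r a = (if lt (r \<otimes> a) (\<zeta> 1) then 0 else 1)"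

lemma carry_mult_in_unit_interval:
  assumes "r \<in> unit_interval" "a \<in> unit_interval"
  shows "\<zeta> (- carry r a) \<otimes> (r \<otimes> a) \<in> unit_interval"
proof -
  have c: "r \<in> carrier E" "a \<in> carrier E" using assms unit_interval_carrier by auto
  have ge: "r = \<one> \<or> lt \<one> r" "a = \<one> \<or> lt \<one> a" and z: "lt r (\<zeta> 1)" "lt a (\<zeta> 1)"
    using assms lt_total by (auto simp: unit_interval_def)
  have "r \<otimes> a = r \<or> lt (r \<otimes> \<one>) (r \<otimes> a)" using ge(2) c by (subst lt_left_iff) auto
  then have ge_r: "r \<otimes> a = r \<or> lt r (r \<otimes> a)" using c by simp
  have "r \<otimes> a = \<one> \<or> lt \<one> (r \<otimes> a)"
    using ge_r ge(1) c lt_trans[of \<one> r "r \<otimes> a"] by auto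
  then have nn: "\<not> lt (r \<otimes> a) \<one>" using lt_trans[of "r \<otimes> a" \<one> "r \<otimes> a"] lt_irrefl c by auto
  show ?thesis
  proof (cases "lt (r \<otimes> a) (\<zeta> 1)")
    case True
    then show ?thesis using nn c by (simp add: carry_def unit_interval_def)
  next
    case False
    have e: "\<zeta> 1 \<otimes> (\<zeta> (-1) \<otimes> (r \<otimes> a)) = r \<otimes> a"
      using c zeta_add[of 1 "-1"] by (simp add: m_assoc[symmetric])
    have "lt (r \<otimes> a) (r \<otimes> \<zeta> 1)" using z c by (simp add: lt_left_iff)
    moreover have "lt (\<zeta> 1 \<otimes> r) (\<zeta> 1 \<otimes> \<zeta> 1)" using z c by (simp add: lt_left_iff)
    ultimately have "lt (r \<otimes> a) (\<zeta> 1 \<otimes> \<zeta> 1)"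
      using c central[of r 1] lt_trans[of "r \<otimes> a" "r \<otimes> \<zeta> 1" "\<zeta> 1 \<otimes> \<zeta> 1"] by auto
    then have 1: "lt (\<zeta> (-1) \<otimes> (r \<otimes> a)) (\<zeta> 1)"
      using e c lt_left_iff[of "\<zeta> 1" "\<zeta> (-1) \<otimes> (r \<otimes> a)" "\<zeta> 1"] by simp
    have "\<not> lt (\<zeta> (-1) \<otimes> (r \<otimes> a)) \<one>"
      using e c False lt_left_iff[of "\<zeta> 1" "\<zeta> (-1) \<otimes> (r \<otimes> a)" \<one>] by simp
    then show ?thesis using 1 False c by (simp add: carry_def unit_interval_def)
  qed
qed

text \<open>
  Whether the translates of the interval exhaust the group can thus be checked on generators.
\<close>

lemma mult_of_translates:
  assumes "r \<in> unit_interval" "a \<in> unit_interval"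
  shows "\<exists>k. \<exists>u\<in>unit_interval. (\<zeta> n \<otimes> r) \<otimes> (\<zeta> m \<otimes> a) = \<zeta> k \<otimes> u"
proof (intro exI bexI)
  have c: "r \<in> carrier E" "a \<in> carrier E" using assms unit_interval_carrier by auto
  have "(\<zeta> n \<otimes> r) \<otimes> (\<zeta> m \<otimes> a) = \<zeta> n \<otimes> (r \<otimes> \<zeta> m) \<otimes> a"
    using c by (simp add: m_assoc)
  also have "\<dots> = \<zeta> (n + m) \<otimes> (r \<otimes> a)"
    using c by (simp add: m_assoc central[OF c(1)] zeta_add)
  also have "\<zeta> (n + m) = \<zeta> (n + m + carry r a) \<otimes> \<zeta> (- carry r a)"
    unfolding zeta_add[symmetric] by simp
  finally show "(\<zeta> n \<otimes> r) \<otimes> (\<zeta> m \<otimes> a) =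
      \<zeta> (n + m + carry r a) \<otimes> (\<zeta> (- carry r a) \<otimes> (r \<otimes> a))"
    using c by (simp add: m_assoc)
qed (rule carry_mult_in_unit_interval[OF assms])

end

text \<open>
  Here \<open>Q\<close> is the quotient of \<open>E\<close> by the range of \<open>\<zeta>\<close>. By \<open>dom\<close> and \<open>ker\<close> the interval is a
  fundamental domain, and \<open>rep\<close> is the resulting section of \<open>p\<close>.
\<close>

locale ordered_cyclic_extension = positive_central_integers E \<zeta> lt + p: group_hom E Q p
  for E :: "('e, 'm) monoid_scheme" (structure) and \<zeta> lt
    and Q :: "('q, 'n) monoid_scheme" and p +
  assumes surj: "p ` carrier E = carrier Q"
    and p_zeta: "p (\<zeta> n) = \<one>\<^bsub>Q\<^esub>"
    and ker: "g \<in> carrier E \<Longrightarrow> p g = \<one>\<^bsub>Q\<^esub> \<Longrightarrow> \<exists>n. g = \<zeta> n"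
    and dom: "g \<in> carrier E \<Longrightarrow> \<exists>n. \<exists>r\<in>unit_interval. g = \<zeta> n \<otimes> r"
begin

lemma p_inj_on_unit_interval:
  assumes "r \<in> unit_interval" "r' \<in> unit_interval" "p r = p r'"
  shows "r = r'"
proof -
  have c: "r \<in> carrier E" "r' \<in> carrier E" using assms unit_interval_carrier by auto
  have "p (r \<otimes> inv r') = \<one>\<^bsub>Q\<^esub>" using c assms by simp
  then obtain n where n: "r \<otimes> inv r' = \<zeta> n" using ker c by (metis inv_closed m_closed)
  then have r: "r = \<zeta> n \<otimes> r'" using c by (simp add: inv_solve_right')
  then have "\<zeta> (-n) \<otimes> r = \<zeta> (-n + n) \<otimes> r'" unfolding zeta_add using c by (simp add: m_assoc)
  then have r': "r' = \<zeta> (-n) \<otimes> r" using c by simp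
  consider "n = 0" | "n \<ge> 1" | "- n \<ge> 1" by linarith
  then show ?thesis
  proof cases
    case 1
    then show ?thesis using r c by simp
  next
    case 2
    then show ?thesis using translate_notin_unit_interval[OF assms(2)] r assms by metis
  next
    case 3
    then show ?thesis using translate_notin_unit_interval[OF assms(1)] r' assms by metis
  qed
qed

definition rep :: "'q \<Rightarrow> 'e" where
  "rep q = (THE r. r \<in> unit_interval \<and> p r = q)"

lemma rep_p: "r \<in> unit_interval \<Longrightarrow> rep (p r) = r"
  unfolding rep_def using p_inj_on_unit_interval by (intro the_equality) auto

lemma obtain_rep:
  assumes "q \<in> carrier Q" obtains r where "r \<in> unit_interval" "q = p r"
proof -
  obtain g where g: "g \<in> carrier E" "q = p g" using assms surj by auto
  then obtain n r where r: "r \<in> unit_interval" "g = \<zeta> n \<otimes> r" using dom by blast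
  then have "q = p r" using g unit_interval_carrier by (simp add: p_zeta)
  then show thesis using that r by blast
qed

lemma rep_mult:
  assumes "r \<in> unit_interval" "a \<in> unit_interval"
  shows "rep (p r \<otimes>\<^bsub>Q\<^esub> p a) = \<zeta> (- carry r a) \<otimes> (r \<otimes> a)"
proof -
  have "p (\<zeta> (- carry r a) \<otimes> (r \<otimes> a)) = p r \<otimes>\<^bsub>Q\<^esub> p a"
    using assms unit_interval_carrier by (simp add: p_zeta)
  then show ?thesis using rep_p[OF carry_mult_in_unit_interval[OF assms]] by simp
qed

text \<open>
  Left multiplication by \<open>r\<close> preserves the order of \<open>a\<close> and \<open>b\<close>, and so does the passage to representatives when
  both products have the same carry. If only \<open>r b\<close> has a carry, then \<open>a < b\<close>, but after translation
  \<open>\<zeta> (-1) r b < r \<le> r a\<close>, so the order is reversed. In every case the sign changes by a coboundary, which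
  the orientation does not see.
\<close>

lemma order_sign_rep_mult:
  assumes "r \<in> unit_interval" "a \<in> unit_interval" "b \<in> unit_interval"
  shows "order_sign lt (rep (p r \<otimes>\<^bsub>Q\<^esub> p a)) (rep (p r \<otimes>\<^bsub>Q\<^esub> p b)) =
    order_sign lt a b - 2 * (carry r b - carry r a)"
proof -
  have c: "r \<in> carrier E" "a \<in> carrier E" "b \<in> carrier E" using assms unit_interval_carrier by auto
  have mixed: "order_sign lt x y = 1 \<and> order_sign lt (r \<otimes> x) (\<zeta> (-1) \<otimes> (r \<otimes> y)) = -1
      \<and> order_sign lt y x = -1 \<and> order_sign lt (\<zeta> (-1) \<otimes> (r \<otimes> y)) (r \<otimes> x) = 1"
    if x: "x \<in> unit_interval" "lt (r \<otimes> x) (\<zeta> 1)" and y: "y \<in> unit_interval" "\<not> lt (r \<otimes> y) (\<zeta> 1)" for x y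
  proof -
    have d: "x \<in> carrier E" "y \<in> carrier E" using x y unit_interval_carrier by auto
    have "r \<otimes> y = \<zeta> 1 \<or> lt (\<zeta> 1) (r \<otimes> y)"
      using y c d lt_total[of "r \<otimes> y" "\<zeta> 1"] by auto
    then have "lt (r \<otimes> x) (r \<otimes> y)"
      using x c d lt_trans[of "r \<otimes> x" "\<zeta> 1" "r \<otimes> y"] by auto
    then have xy: "lt x y" using c d by (simp add: lt_left_iff)
    have "\<zeta> (-1) \<otimes> (r \<otimes> y) = r \<otimes> (\<zeta> (-1) \<otimes> y)"
      using c d central[of r "-1"] by (simp add: m_assoc[symmetric])
    moreover have "lt (\<zeta> (-1) \<otimes> y) x"
    proof -
      have e: "\<zeta> 1 \<otimes> (\<zeta> (-1) \<otimes> y) = y"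
        using d zeta_add[of 1 "-1"] by (simp add: m_assoc[symmetric])
      have "lt y (\<zeta> 1)" using y by (simp add: unit_interval_def)
      then have 1: "lt (\<zeta> (-1) \<otimes> y) \<one>"
        using e d lt_left_iff[of "\<zeta> 1" "\<zeta> (-1) \<otimes> y" \<one>] by simp
      have "x = \<one> \<or> lt \<one> x" using x d lt_total by (auto simp: unit_interval_def)
      then show ?thesis using 1 d lt_trans[of "\<zeta> (-1) \<otimes> y" \<one> x] by auto
    qed
    ultimately have yx: "lt (\<zeta> (-1) \<otimes> (r \<otimes> y)) (r \<otimes> x)" using c d by (simp add: lt_left_iff)
    have asym: "\<not> lt v u" if "lt u v" "u \<in> carrier E" "v \<in> carrier E" for u v
      using that lt_trans lt_irrefl by blast
    show ?thesis using xy yx c d by (simp add: order_sign_def asym)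
  qed
  have same: "order_sign lt (\<zeta> n \<otimes> (r \<otimes> a)) (\<zeta> n \<otimes> (r \<otimes> b)) = order_sign lt a b" for n
    using c by (simp add: order_sign_left)
  show ?thesis
    unfolding rep_mult[OF assms(1,2)] rep_mult[OF assms(1,3)]
    using same[of "-1"] same[of 0] mixed[of a b] mixed[of b a] assms c
    by (auto simp: carry_def)
qed

definition induced :: "'q \<Rightarrow> 'q \<Rightarrow> 'q \<Rightarrow> int" where
  "induced x y w = orientation lt (rep x) (rep y) (rep w)"

lemma induced_p:
  "a \<in> unit_interval \<Longrightarrow> b \<in> unit_interval \<Longrightarrow> x \<in> unit_interval \<Longrightarrow> induced (p a) (p b) (p x) = orientation lt a b x"
  by (simp add: induced_def rep_p)

lemma circular_ordering_induced: "circular_ordering Q induced"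
proof -
  have ord: "irreflp_on unit_interval lt" "transp_on unit_interval lt" "totalp_on unit_interval lt"
    using lo unit_interval_carrier unfolding left_ordering_def
    by (auto intro: irreflp_on_subset transp_on_subset totalp_on_subset)
  have inD: "rep q \<in> unit_interval \<and> p (rep q) = q" if "q \<in> carrier Q" for q
    using that obtain_rep rep_p by metis
  have inj: "rep q = rep q' \<longleftrightarrow> q = q'" if "q \<in> carrier Q" "q' \<in> carrier Q" for q q'
    using that inD by metis
  have invar: "induced (g \<otimes>\<^bsub>Q\<^esub> x) (g \<otimes>\<^bsub>Q\<^esub> y) (g \<otimes>\<^bsub>Q\<^esub> w) = induced x y w"
    if q: "g \<in> carrier Q" "x \<in> carrier Q" "y \<in> carrier Q" "w \<in> carrier Q" for g x y w
  proof -
    obtain r a b u where r: "r \<in> unit_interval" "a \<in> unit_interval" "b \<in> unit_interval" "u \<in> unit_interval" "g = p r" "x = p a" "y = p b" "w = p u"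
      using q obtain_rep by metis
    show ?thesis using r
      by (simp add: induced_def orientation_def order_sign_rep_mult rep_p)
  qed
  show ?thesis
    unfolding circular_ordering_def
  proof (intro conjI ballI)
    fix x y w assume *: "x \<in> carrier Q" "y \<in> carrier Q" "w \<in> carrier Q"
    then have "rep x \<in> unit_interval" "rep y \<in> unit_interval" "rep w \<in> unit_interval" using inD by auto
    from orientation_range[OF ord this]
    show "induced x y w \<in> {-1, 0, 1}" "induced x y w = 0 \<longleftrightarrow> x = y \<or> x = w \<or> y = w"
      unfolding induced_def using inj * by simp_all
  qed (simp_all add: invar, simp add: induced_def orientation_def)
qed

end

section \<open>The left-ordered lift of a circularly ordered group\<close>

lemma lift_group_simps:
  "carrier (lift_group G c) = UNIV \<times> carrier G"
  "(n, a) \<otimes>\<^bsub>lift_group G c\<^esub> (m, b) = (n + m + lift_cocycle G c a b, a \<otimes>\<^bsub>G\<^esub> b)"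
  "\<one>\<^bsub>lift_group G c\<^esub> = (0, \<one>\<^bsub>G\<^esub>)"
  by (simp_all add: lift_group_def)

lemma lift_cocycle_one [simp]:
  "lift_cocycle G c \<one>\<^bsub>G\<^esub> a = 0" "lift_cocycle G c a \<one>\<^bsub>G\<^esub> = 0"
  by (simp_all add: lift_cocycle_def)

lemma lift_cocycle_01: "lift_cocycle G c a b = 0 \<or> lift_cocycle G c a b = 1"
  by (simp add: lift_cocycle_def)

locale circularly_ordered_group = group G for G (structure) +
  fixes c
  assumes circ: "circular_ordering G c"
begin

abbreviation "L \<equiv> lift_group G c"

sublocale lift: group L
  using circ group_axioms by (rule group_lift_group[rotated])

lemma circ_range: "x \<in> carrier G \<Longrightarrow> y \<in> carrier G \<Longrightarrow> w \<in> carrier G \<Longrightarrow>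
    c x y w = -1 \<or> c x y w = 0 \<or> c x y w = 1"
  using circ unfolding circular_ordering_def by blast

lemma circ_zero: "x \<in> carrier G \<Longrightarrow> y \<in> carrier G \<Longrightarrow> w \<in> carrier G \<Longrightarrow>
    c x y w = 0 \<longleftrightarrow> x = y \<or> x = w \<or> y = w"
  using circ unfolding circular_ordering_def by blast

lemma circ_cocycle: "x \<in> carrier G \<Longrightarrow> y \<in> carrier G \<Longrightarrow> w \<in> carrier G \<Longrightarrow> v \<in> carrier G \<Longrightarrow>
    c y w v - c x w v + c x y v - c x y w = 0"
  using circ unfolding circular_ordering_def by blast

lemma circ_left: "g \<in> carrier G \<Longrightarrow> x \<in> carrier G \<Longrightarrow> y \<in> carrier G \<Longrightarrow> w \<in> carrier G \<Longrightarrow>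
    c (g \<otimes> x) (g \<otimes> y) (g \<otimes> w) = c x y w"
  using circ unfolding circular_ordering_def by blast

lemma lift_cocycle_inverse:
  "a \<in> carrier G \<Longrightarrow> lift_cocycle G c (inv a) a = (if a = \<one> then 0 else 1)"
  using circ_zero[of \<one> "inv a" \<one>] by (simp add: lift_cocycle_def)

lemma inv_lift:
  assumes "a \<in> carrier G"
  shows "inv\<^bsub>L\<^esub> (n, a) = (- n - lift_cocycle G c (inv a) a, inv a)"
  by (rule lift.inv_equality) (use assms in \<open>simp_all add: lift_group_simps\<close>)

text \<open>
  The cocycle takes the value \<open>1\<close> on a nontrivial pair of mutually inverse elements. So a product of positive
  elements cannot be the identity, and of a non-identity element \<open>(n, a)\<close> and its inverse at least one is positive.
\<close>

lemma left_ordering_lift: "left_ordering L (lift_less G c)"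
  unfolding lift_less_def
proof (rule left_ordering_of_cone)
  show "group L" by (rule lift.is_group)
  show "lift_cone G \<subseteq> carrier L" by (auto simp: lift_cone_def lift_group_simps)
  show "\<one>\<^bsub>L\<^esub> \<notin> lift_cone G" by (simp add: lift_cone_def lift_group_simps)
next
  fix u v assume uv: "u \<in> lift_cone G" "v \<in> lift_cone G"
  obtain n a m b where e: "u = (n, a)" "v = (m, b)" by fastforce
  have *: "n \<ge> 0" "m \<ge> 0" "a \<in> carrier G" "b \<in> carrier G"
    "n \<noteq> 0 \<or> a \<noteq> \<one>" "m \<noteq> 0 \<or> b \<noteq> \<one>"
    using uv by (auto simp: e lift_cone_def)
  let ?f = "lift_cocycle G c a b"
  have f: "?f = 0 \<or> ?f = 1" by (rule lift_cocycle_01)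
  have "\<not> (n + m + ?f = 0 \<and> a \<otimes> b = \<one>)"
  proof
    assume h: "n + m + ?f = 0 \<and> a \<otimes> b = \<one>"
    then have "n = 0" "m = 0" "?f = 0" using * f by auto
    moreover have "a = inv b" using h * by (metis inv_equality)
    ultimately show False using * lift_cocycle_inverse[of b] by simp
  qed
  then show "u \<otimes>\<^bsub>L\<^esub> v \<in> lift_cone G"
    using * f by (auto simp: e lift_group_simps lift_cone_def)
next
  fix u assume u: "u \<in> carrier L" "u \<noteq> \<one>\<^bsub>L\<^esub>"
  obtain n a where e: "u = (n, a)" by fastforce
  show "u \<in> lift_cone G \<or> inv\<^bsub>L\<^esub> u \<in> lift_cone G"
    using u by (auto simp: e lift_group_simps lift_cone_def inv_lift lift_cocycle_inverse)
qed

text \<open>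
  On the elements \<open>(0, a)\<close>, which are those from \<open>(0, 1)\<close> on and before \<open>(1, 1)\<close>, the left ordering is the circular
  ordering cut open at the identity.
\<close>

lemma lift_less_0_iff:
  assumes a: "a \<in> carrier G" and b: "b \<in> carrier G"
  shows "lift_less G c (0, a) (0, b) \<longleftrightarrow> a = \<one> \<and> b \<noteq> \<one> \<or> c \<one> a b = 1"
proof -
  have e: "lift_less G c (0, a) (0, b) \<longleftrightarrow>
    lift_cocycle G c (inv a) b \<ge> (if a = \<one> then 0 else 1) \<and>
     (lift_cocycle G c (inv a) b \<noteq> (if a = \<one> then 0 else 1) \<or> inv a \<otimes> b \<noteq> \<one>)"
    using a b by (auto simp: lift_less_def less_of_cone_def inv_lift lift_group_simps
      lift_cocycle_inverse lift_cone_def)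
  have 1: "inv a \<otimes> b = \<one> \<longleftrightarrow> a = b" using a b by (metis inv_closed inv_equality inv_inv l_inv)
  have 2: "c \<one> (inv a) (inv a \<otimes> b) = c a \<one> b"
    using circ_left[of a \<one> "inv a" "inv a \<otimes> b"] a b by (simp add: m_assoc[symmetric])
  have 3: "c \<one> a b = - c a \<one> b"
    using circ_cocycle[of \<one> a \<one> b] circ_zero[of \<one> a \<one>] circ_zero[of \<one> \<one> b] a b by simp
  have 4: "lift_cocycle G c (inv a) b = (if a = \<one> \<or> b = \<one> \<or> c \<one> a b = -1 then 0 else 1)"
    using a b 2 3 by (auto simp: lift_cocycle_def)
  show ?thesis
    using e 1 4 circ_range[of \<one> a b] circ_zero[of \<one> a b] a b by (auto split: if_splits)
qed

text \<open>
  The sign of the pair \<open>(0, u), (0, v)\<close> is \<open>c 1 u v\<close> up to the coboundary of the indicator function of the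
  non-identity elements, and the coboundary of \<open>c 1\<close> is \<open>c\<close> by the cocycle identity.
\<close>

lemma orientation_lift:
  assumes "a \<in> carrier G" "b \<in> carrier G" "x \<in> carrier G"
  shows "orientation (lift_less G c) (0, a) (0, b) (0, x) = c a b x"
proof -
  have s: "order_sign (lift_less G c) (0, u) (0, v) =
      c \<one> u v + ((if v = \<one> then 0 else 1) - (if u = \<one> then 0 else 1))"
    if "u \<in> carrier G" "v \<in> carrier G" for u v
  proof -
    have 3: "c \<one> u v = - c \<one> v u"
      using circ_cocycle[of \<one> u v u] circ_zero[of \<one> u u] circ_zero[of u v u] that by simp
    show ?thesis
      using 3 circ_range[of \<one> u v] circ_zero[of \<one> u v] that
      by (auto simp: order_sign_def lift_less_0_iff)
  qed
  show ?thesis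
    using circ_cocycle[of \<one> a b x] assms by (simp add: orientation_def s)
qed

end

lemma lift_map_Pair: "lift_map f (n, x) = (n, f x)"
  by (simp add: lift_map_def)

text \<open>
  Injectivity has to be assumed separately: a circular ordering contains no information about pairs, so on a group
  with two elements every homomorphism preserves it, although the trivial one does not lift.
\<close>

lemma lift_map_mono:
  assumes "group G" "group K" "f \<in> hom G K" "inj_on f (carrier G)"
    and pres: "circular_order_preserving G c C f"
    and "circular_ordering G c" "circular_ordering K C"
  shows "lift_map f \<in> hom (lift_group G c) (lift_group K C)"
    and "u \<in> carrier (lift_group G c) \<Longrightarrow> v \<in> carrier (lift_group G c) \<Longrightarrow>
      lift_less K C (lift_map f u) (lift_map f v) \<longleftrightarrow> lift_less G c u v"
proof -
  interpret G: circularly_ordered_group G c using assms by (simp add: circularly_ordered_group_def circularly_ordered_group_axioms_def)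
  interpret K: circularly_ordered_group K C using assms by (simp add: circularly_ordered_group_def circularly_ordered_group_axioms_def)
  interpret f: group_hom G K f using assms by (simp add: group_hom_def group_hom_axioms_def)
  have one: "f a = \<one>\<^bsub>K\<^esub> \<longleftrightarrow> a = \<one>\<^bsub>G\<^esub>" if "a \<in> carrier G" for a
    using that assms(4) f.hom_one G.one_closed by (metis inj_onD)
  have coc: "lift_cocycle K C (f a) (f b) = lift_cocycle G c a b"
    if "a \<in> carrier G" "b \<in> carrier G" for a b
  proof -
    have "c \<one>\<^bsub>G\<^esub> a (a \<otimes>\<^bsub>G\<^esub> b) = C (f \<one>\<^bsub>G\<^esub>) (f a) (f (a \<otimes>\<^bsub>G\<^esub> b))"
      using pres that unfolding circular_order_preserving_def by blast
    then show ?thesis using that one by (simp add: lift_cocycle_def)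
  qed
  show h: "lift_map f \<in> hom (lift_group G c) (lift_group K C)"
    by (rule homI) (auto simp: lift_map_Pair lift_group_simps coc)
  interpret l: group_hom G.L K.L "lift_map f"
    using h G.lift.is_group K.lift.is_group by (simp add: group_hom_def group_hom_axioms_def)
  have cone: "lift_map f w \<in> lift_cone K \<longleftrightarrow> w \<in> lift_cone G" if "w \<in> carrier G.L" for w
    using that one by (auto simp: lift_map_Pair lift_group_simps lift_cone_def)
  show "lift_less K C (lift_map f u) (lift_map f v) \<longleftrightarrow> lift_less G c u v"
    if "u \<in> carrier G.L" "v \<in> carrier G.L"
  proof -
    have "inv\<^bsub>K.L\<^esub> (lift_map f u) \<otimes>\<^bsub>K.L\<^esub> lift_map f v = lift_map f (inv\<^bsub>G.L\<^esub> u \<otimes>\<^bsub>G.L\<^esub> v)"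
      using that by simp
    then show ?thesis
      using that cone[of "inv\<^bsub>G.L\<^esub> u \<otimes>\<^bsub>G.L\<^esub> v"] by (simp only: lift_less_def less_of_cone_def) simp
  qed
qed

lemma snd_lift_hom: "snd \<in> hom (lift_group G c) G"
  by (rule homI) (auto simp: lift_group_simps)

section \<open>The amalgam of the lifts as a central extension\<close>

text \<open>
  An index \<open>i0\<close> is singled out because the central integers of the lifted amalgam live in the factors.
\<close>

locale circular_amalgam = amalgam_data I G H \<phi>
  for I :: "'i set" and G :: "'i \<Rightarrow> ('a, 'm) monoid_scheme"
    and H :: "('b, 'n) monoid_scheme" and \<phi> +
  fixes c :: "'i \<Rightarrow> 'a \<Rightarrow> 'a \<Rightarrow> 'a \<Rightarrow> int" and d :: "'b \<Rightarrow> 'b \<Rightarrow> 'b \<Rightarrow> int" and i0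
  assumes circ_G: "i \<in> I \<Longrightarrow> circular_ordering (G i) (c i)"
    and circ_H: "circular_ordering H d"
    and inj_\<phi>: "i \<in> I \<Longrightarrow> inj_on (\<phi> i) (carrier H)"
    and pres_\<phi>: "i \<in> I \<Longrightarrow> circular_order_preserving H d (c i) (\<phi> i)"
    and base: "i0 \<in> I"
begin

abbreviation "G' \<equiv> \<lambda>i. lift_group (G i) (c i)"
abbreviation "H' \<equiv> lift_group H d"
abbreviation "\<phi>' \<equiv> \<lambda>i. lift_map (\<phi> i)"
abbreviation "incl \<equiv> amalgam_incl I G H \<phi>"
abbreviation "incl' \<equiv> amalgam_incl I G' H' \<phi>'"

lemma circ_group: "i \<in> I \<Longrightarrow> circularly_ordered_group (G i) (c i)"
  by (simp add: circularly_ordered_group_def circularly_ordered_group_axioms_def group_G circ_G)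

sublocale L: amalgam_data I G' H' \<phi>'
proof (rule amalgam_data.intro)
  fix i assume i: "i \<in> I"
  show "group (G' i)" by (rule group_lift_group[OF group_G circ_G]) fact+
  show "lift_map (\<phi> i) \<in> hom H' (G' i)"
    using i by (intro lift_map_mono(1) group_H group_G hom_\<phi> inj_\<phi> pres_\<phi> circ_H circ_G)
next
  show "group H'" by (rule group_lift_group[OF group_H circ_H])
qed

sublocale K: group K by (rule group_amalgam)
sublocale LK: group L.K by (rule L.group_amalgam)

definition \<zeta> :: "int \<Rightarrow> ('i \<times> int \<times> 'a) list set" where
  "\<zeta> n = incl' i0 (n, \<one>\<^bsub>G i0\<^esub>)"

lemma zeta_eq: assumes "i \<in> I" shows "\<zeta> n = incl' i (n, \<one>\<^bsub>G i\<^esub>)"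
proof -
  interpret H: group H by (rule group_H)
  have "incl' j (lift_map (\<phi> j) (n, \<one>\<^bsub>H\<^esub>)) = incl' j (n, \<one>\<^bsub>G j\<^esub>)" if "j \<in> I" for j
    using hom_one[OF hom_\<phi>[OF that] group_H group_G[OF that]] by (simp add: lift_map_Pair)
  moreover have "incl' i (lift_map (\<phi> i) (n, \<one>\<^bsub>H\<^esub>)) = incl' i0 (lift_map (\<phi> i0) (n, \<one>\<^bsub>H\<^esub>))"
    using assms base by (intro L.amalgam_incl_glue) (auto simp: lift_group_simps)
  ultimately show ?thesis using assms base by (simp add: \<zeta>_def)
qed

lemma incl'_carrier [simp]: "i \<in> I \<Longrightarrow> x \<in> carrier (G i) \<Longrightarrow> incl' i (n, x) \<in> carrier L.K"
  by (intro L.incl_carrier) (auto simp: lift_group_simps)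

lemma incl'_mult:
  assumes "i \<in> I" "x \<in> carrier (G i)" "y \<in> carrier (G i)"
  shows "incl' i (n, x) \<otimes>\<^bsub>L.K\<^esub> incl' i (m, y) =
    incl' i (n + m + lift_cocycle (G i) (c i) x y, x \<otimes>\<^bsub>G i\<^esub> y)"
  using hom_mult[OF L.amalgam_incl_hom[OF assms(1)], of "(n, x)" "(m, y)"] assms
  by (simp add: lift_group_simps)

lemma zeta_carrier [simp]: "\<zeta> n \<in> carrier L.K"
proof -
  interpret group "G i0" using base by (rule group_G)
  show ?thesis unfolding \<zeta>_def using base by simp
qed

lemma zeta_mult: assumes "i \<in> I" "x \<in> carrier (G i)"
  shows "\<zeta> n \<otimes>\<^bsub>L.K\<^esub> incl' i (m, x) = incl' i (n + m, x)"
    and "incl' i (m, x) \<otimes>\<^bsub>L.K\<^esub> \<zeta> n = incl' i (n + m, x)"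
proof -
  interpret group "G i" using assms by (simp add: group_G)
  show "\<zeta> n \<otimes>\<^bsub>L.K\<^esub> incl' i (m, x) = incl' i (n + m, x)"
    "incl' i (m, x) \<otimes>\<^bsub>L.K\<^esub> \<zeta> n = incl' i (n + m, x)"
    using assms by (simp_all add: zeta_eq[OF assms(1)] incl'_mult add.commute)
qed

lemma zeta_hom: "\<zeta> \<in> hom integer_group L.K"
proof (rule homI)
  interpret group "G i0" using base by (rule group_G)
  show "\<zeta> (n \<otimes>\<^bsub>integer_group\<^esub> m) = \<zeta> n \<otimes>\<^bsub>L.K\<^esub> \<zeta> m" for n m
    using zeta_mult(1)[OF base one_closed, of n m] by (simp add: \<zeta>_def)
qed simp

lemma zeta_central: "A \<in> carrier L.K \<Longrightarrow> A \<otimes>\<^bsub>L.K\<^esub> \<zeta> n = \<zeta> n \<otimes>\<^bsub>L.K\<^esub> A"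
proof (induction A rule: L.amalgam_induct)
  case one
  then show ?case by simp
next
  case (incl_mult i x B)
  obtain m a where x: "x = (m, a)" "a \<in> carrier (G i)"
    using incl_mult by (auto simp: lift_group_simps)
  have "incl' i x \<otimes>\<^bsub>L.K\<^esub> B \<otimes>\<^bsub>L.K\<^esub> \<zeta> n = (incl' i x \<otimes>\<^bsub>L.K\<^esub> \<zeta> n) \<otimes>\<^bsub>L.K\<^esub> B"
    using incl_mult x by (simp add: LK.m_assoc)
  also have "\<dots> = \<zeta> n \<otimes>\<^bsub>L.K\<^esub> incl' i x \<otimes>\<^bsub>L.K\<^esub> B"
    using incl_mult x by (simp add: zeta_mult)
  finally show ?case using incl_mult x by (simp add: LK.m_assoc)
qed

text \<open>
  An inverse of \<open>\<pi>\<close> modulo the central integers comes from the universal property of the amalgam of the \<open>G\<^sub>i\<close>: the maps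
  \<open>x \<mapsto> (0, x)\<close> are multiplicative up to the values of the lifting cocycle, hence homomorphisms into the quotient.
\<close>

lemma projection:
  obtains \<pi> where "\<pi> \<in> hom L.K K"
    and "\<And>i n x. i \<in> I \<Longrightarrow> x \<in> carrier (G i) \<Longrightarrow> \<pi> (incl' i (n, x)) = incl i x"
    and "\<pi> ` carrier L.K = carrier K"
    and "\<And>A. A \<in> carrier L.K \<Longrightarrow> \<pi> A = \<one>\<^bsub>K\<^esub> \<Longrightarrow> \<exists>n. A = \<zeta> n"
proof -
  have snd_hom: "incl i \<circ> snd \<in> hom (G' i) K" if "i \<in> I" for i
    using hom_compose[OF snd_lift_hom amalgam_incl_hom[OF that]] .
  have snd_compat: "(incl i \<circ> snd) (\<phi>' i h) = (incl j \<circ> snd) (\<phi>' j h)"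
    if "i \<in> I" "j \<in> I" "h \<in> carrier H'" for i j h
    using that amalgam_incl_glue[OF that(1,2), of "snd h"]
    by (cases h) (simp add: lift_map_Pair lift_group_simps)
  obtain \<pi> where pi: "\<pi> \<in> hom L.K K"
    and pi_incl: "\<And>i x. i \<in> I \<Longrightarrow> x \<in> carrier (G' i) \<Longrightarrow> \<pi> (incl' i x) = (incl i \<circ> snd) x"
  proof (rule L.amalgam_universal[OF group_amalgam snd_hom snd_compat])
    fix F assume "F \<in> hom L.K K"
      "\<And>i x. i \<in> I \<Longrightarrow> x \<in> carrier (G' i) \<Longrightarrow> F (incl' i x) = (incl i \<circ> snd) x"
    then show thesis by (rule that)
  qed
  have pi_incl: "\<pi> (incl' i (n, x)) = incl i x" if "i \<in> I" "x \<in> carrier (G i)" for i n x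
    using pi_incl[of i "(n, x)"] that by (simp add: lift_group_simps)
  interpret \<pi>: group_hom L.K K \<pi>
    using pi by (simp add: group_hom_def group_hom_axioms_def LK.is_group K.is_group)
  have surj: "\<pi> ` carrier L.K = carrier K"
  proof -
    have "A \<in> \<pi> ` carrier L.K" if "A \<in> carrier K" for A
      using that
    proof (induction A rule: amalgam_induct)
      case one
      show ?case using imageI[OF LK.one_closed, of \<pi>] by simp
    next
      case (incl_mult i x B)
      then obtain B' where B': "B' \<in> carrier L.K" "B = \<pi> B'" by auto
      have "incl i x \<otimes>\<^bsub>K\<^esub> B = \<pi> (incl' i (0, x) \<otimes>\<^bsub>L.K\<^esub> B')"
        using incl_mult B' by (simp add: pi_incl)
      moreover have "incl' i (0, x) \<otimes>\<^bsub>L.K\<^esub> B' \<in> carrier L.K" using incl_mult B' by simp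
      ultimately show ?case by (rule image_eqI)
    qed
    then show ?thesis by auto
  qed
  \<comment> \<open>The inverse modulo the central integers.\<close>
  define N where "N = range \<zeta>"
  have "subgroup N L.K"
  proof -
    interpret Z: group integer_group by (rule group_integer_group)
    interpret z: group_hom integer_group L.K \<zeta>
      using zeta_hom by (simp add: group_hom_def group_hom_axioms_def LK.is_group)
    show ?thesis using z.img_is_subgroup by (simp add: N_def)
  qed
  then interpret N: normal N L.K
    by (intro LK.normalI) (auto simp: r_coset_def l_coset_def N_def zeta_central)
  have q: "(\<lambda>A. N #>\<^bsub>L.K\<^esub> A) \<in> hom L.K (L.K Mod N)" by (rule N.r_coset_hom_Mod)
  have coset: "N #>\<^bsub>L.K\<^esub> incl' i (n, x) = N #>\<^bsub>L.K\<^esub> incl' i (0, x)"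
    if "i \<in> I" "x \<in> carrier (G i)" for i n x
  proof -
    have "incl' i (n, x) = \<zeta> n \<otimes>\<^bsub>L.K\<^esub> incl' i (0, x)" using that by (simp add: zeta_mult)
    moreover have "\<zeta> n \<in> N" by (simp add: N_def)
    ultimately have "N #>\<^bsub>L.K\<^esub> incl' i (n, x) = N #>\<^bsub>L.K\<^esub> \<zeta> n #>\<^bsub>L.K\<^esub> incl' i (0, x)"
      using that by (simp add: LK.coset_mult_assoc N.subset)
    then show ?thesis using \<open>\<zeta> n \<in> N\<close> N.rcos_const[OF LK.is_group] by simp
  qed
  let ?t = "\<lambda>i x. N #>\<^bsub>L.K\<^esub> incl' i (0, x)"
  have t_hom: "?t i \<in> hom (G i) (L.K Mod N)" if i: "i \<in> I" for i
  proof (rule homI)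
    interpret Gi: group "G i" using i by (rule group_G)
    show "?t i x \<in> carrier (L.K Mod N)" if "x \<in> carrier (G i)" for x
      using hom_in_carrier[OF q] i that by simp
    show "?t i (x \<otimes>\<^bsub>G i\<^esub> y) = ?t i x \<otimes>\<^bsub>L.K Mod N\<^esub> ?t i y"
      if xy: "x \<in> carrier (G i)" "y \<in> carrier (G i)" for x y
      using hom_mult[OF q, of "incl' i (0, x)" "incl' i (0, y)"] i xy
        coset[OF i, of "x \<otimes>\<^bsub>G i\<^esub> y" "lift_cocycle (G i) (c i) x y"]
      by (simp add: incl'_mult)
  qed
  have t_compat: "?t i (\<phi> i h) = ?t j (\<phi> j h)" if "i \<in> I" "j \<in> I" "h \<in> carrier H" for i j h
    using L.amalgam_incl_glue[of i j "(0, h)"] that by (simp add: lift_group_simps lift_map_Pair)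
  obtain \<theta> where th: "\<theta> \<in> hom K (L.K Mod N)"
    and th_incl: "\<And>i x. i \<in> I \<Longrightarrow> x \<in> carrier (G i) \<Longrightarrow> \<theta> (incl i x) = ?t i x"
  proof (rule amalgam_universal[OF N.factorgroup_is_group t_hom t_compat])
    fix F assume "F \<in> hom K (L.K Mod N)"
      "\<And>i x. i \<in> I \<Longrightarrow> x \<in> carrier (G i) \<Longrightarrow> F (incl i x) = ?t i x"
    then show thesis by (rule that)
  qed
  have ker: "\<exists>n. A = \<zeta> n" if A: "A \<in> carrier L.K" "\<pi> A = \<one>\<^bsub>K\<^esub>" for A
  proof -
    have "(\<theta> \<circ> \<pi>) A = N #>\<^bsub>L.K\<^esub> A"
    proof (rule L.amalgam_hom_unique[OF N.factorgroup_is_group _ q _ A(1)])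
      show "\<theta> \<circ> \<pi> \<in> hom L.K (L.K Mod N)" using hom_compose[OF pi th] .
      show "(\<theta> \<circ> \<pi>) (incl' i x) = N #>\<^bsub>L.K\<^esub> incl' i x" if "i \<in> I" "x \<in> carrier (G' i)" for i x
        using that coset[of i "snd x" "fst x"]
        by (cases x) (simp add: lift_group_simps pi_incl th_incl)
    qed
    moreover have "\<theta> \<one>\<^bsub>K\<^esub> = N"
      using hom_one[OF th K.is_group N.factorgroup_is_group] by (simp add: FactGroup_def)
    ultimately have "N #>\<^bsub>L.K\<^esub> A = N" using A by simp
    then have "A \<in> N" using LK.rcos_self[OF A(1) N.subgroup_axioms] by simp
    then show ?thesis by (auto simp: N_def)
  qed
  show thesis by (rule that[OF pi pi_incl surj ker])
qed

section \<open>From left orderings of the lifted amalgam to circular orderings\<close>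

lemma circular_ordering_of_left_ordering:
  assumes lo: "left_ordering L.K lt"
    and ext: "\<And>i x y. i \<in> I \<Longrightarrow> x \<in> carrier (G' i) \<Longrightarrow> y \<in> carrier (G' i) \<Longrightarrow>
      lt (incl' i x) (incl' i y) \<longleftrightarrow> lift_less (G i) (c i) x y"
  shows "\<exists>C. circular_ordering K C \<and>
    (\<forall>i\<in>I. circular_order_preserving (G i) (c i) C (incl i))"
proof -
  obtain \<pi> where pi: "\<pi> \<in> hom L.K K"
    and pi_incl: "\<And>i n x. i \<in> I \<Longrightarrow> x \<in> carrier (G i) \<Longrightarrow> \<pi> (incl' i (n, x)) = incl i x"
    and surj: "\<pi> ` carrier L.K = carrier K"
    and ker: "\<And>A. A \<in> carrier L.K \<Longrightarrow> \<pi> A = \<one>\<^bsub>K\<^esub> \<Longrightarrow> \<exists>n. A = \<zeta> n"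
    by (rule projection) blast
  interpret \<pi>: group_hom L.K K \<pi>
    using pi by (simp add: group_hom_def group_hom_axioms_def LK.is_group K.is_group)
  have one_incl: "\<one>\<^bsub>L.K\<^esub> = incl' i (0, \<one>\<^bsub>G i\<^esub>)" if "i \<in> I" for i
    using hom_one[OF L.amalgam_incl_hom[OF that] L.group_G[OF that] LK.is_group]
    by (simp add: lift_group_simps)
  have incl_unit_interval: "incl' i (0, x) \<in> {r \<in> carrier L.K. \<not> lt r \<one>\<^bsub>L.K\<^esub> \<and> lt r (\<zeta> 1)}" if i: "i \<in> I" and x: "x \<in> carrier (G i)" for i x
  proof -
    interpret Gi: circularly_ordered_group "G i" "c i" using i by (rule circ_group)
    have "\<not> lift_less (G i) (c i) (0, x) (0, \<one>\<^bsub>G i\<^esub>)"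
      using x Gi.circ_zero[of "\<one>\<^bsub>G i\<^esub>" x "\<one>\<^bsub>G i\<^esub>"] by (simp add: Gi.lift_less_0_iff)
    moreover have "lift_less (G i) (c i) (0, x) (1, \<one>\<^bsub>G i\<^esub>)"
      using x by (auto simp: lift_less_def less_of_cone_def Gi.inv_lift lift_group_simps
          Gi.lift_cocycle_inverse lift_cone_def)
    ultimately show ?thesis
      using i x by (simp add: zeta_eq[OF i] one_incl[OF i] ext lift_group_simps)
  qed
  have zeta_pos: "lt \<one>\<^bsub>L.K\<^esub> (\<zeta> 1)"
    using incl_unit_interval[OF base] group.is_monoid[OF group_G[OF base]] one_incl[OF base]
    by (simp add: monoid.one_closed)
  interpret Z: positive_central_integers L.K \<zeta> lt
    by unfold_locales (use lo zeta_hom zeta_central zeta_pos in auto)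
  note incl_unit_interval = incl_unit_interval[folded Z.unit_interval_def]
  have "\<exists>n. \<exists>r\<in>Z.unit_interval. A = \<zeta> n \<otimes>\<^bsub>L.K\<^esub> r" if "A \<in> carrier L.K" for A
    using that
  proof (induction A rule: L.amalgam_induct)
    case one
    have "\<one>\<^bsub>L.K\<^esub> \<in> Z.unit_interval" using zeta_pos by (simp add: Z.unit_interval_def Z.lt_irrefl)
    then show ?case by (intro exI[of _ 0] bexI[of _ "\<one>\<^bsub>L.K\<^esub>"]) simp_all
  next
    case (incl_mult i x B)
    obtain n a where x: "x = (n, a)" "a \<in> carrier (G i)"
      using incl_mult by (auto simp: lift_group_simps)
    obtain m r where B: "r \<in> Z.unit_interval" "B = \<zeta> m \<otimes>\<^bsub>L.K\<^esub> r" using incl_mult by blast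
    have "incl' i x = \<zeta> n \<otimes>\<^bsub>L.K\<^esub> incl' i (0, a)" using incl_mult x by (simp add: zeta_mult)
    then show ?case
      using Z.mult_of_translates[OF incl_unit_interval[OF incl_mult(1) x(2)] B(1), of n m] B by simp
  qed
  then interpret X: ordered_cyclic_extension L.K \<zeta> lt K \<pi>
  proof unfold_locales
    show "\<pi> (\<zeta> n) = \<one>\<^bsub>K\<^esub>" for n
      using base hom_one[OF amalgam_incl_hom[OF base] group_G[OF base] K.is_group]
        monoid.one_closed[OF group.is_monoid[OF group_G[OF base]]]
      by (simp add: \<zeta>_def pi_incl)
  qed (use surj ker in auto)
  show ?thesis
  proof (intro exI conjI ballI)
    show "circular_ordering K X.induced" by (rule X.circular_ordering_induced)
    fix i assume i: "i \<in> I"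
    interpret Gi: circularly_ordered_group "G i" "c i" using i by (rule circ_group)
    show "circular_order_preserving (G i) (c i) X.induced (incl i)"
      unfolding circular_order_preserving_def
    proof (intro ballI)
      fix x y w assume *: "x \<in> carrier (G i)" "y \<in> carrier (G i)" "w \<in> carrier (G i)"
      have "X.induced (incl i x) (incl i y) (incl i w) =
          orientation lt (incl' i (0, x)) (incl' i (0, y)) (incl' i (0, w))"
        using X.induced_p[OF incl_unit_interval[OF i *(1)] incl_unit_interval[OF i *(2)] incl_unit_interval[OF i *(3)]] i *
        by (simp add: pi_incl)
      also have "\<dots> = orientation (lift_less (G i) (c i)) (0, x) (0, y) (0, w)"
        using i * by (simp add: orientation_def order_sign_def ext lift_group_simps)
      also have "\<dots> = c i x y w" using * by (rule Gi.orientation_lift)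
      finally show "c i x y w = X.induced (incl i x) (incl i y) (incl i w)" by simp
    qed
  qed
qed

section \<open>From circular orderings of the amalgam to left orderings\<close>

text \<open>
  If \<open>incl i\<close> kills \<open>t \<noteq> 1\<close>, then \<open>c\<^sub>i 1 t w = 0\<close> for all \<open>w\<close>, so \<open>G\<^sub>i = {1, t}\<close>. If \<open>t\<close> comes from
  \<open>h \<in> H\<close>, the same argument applies to every factor, so all \<open>\<phi>\<^sub>j\<close> are isomorphisms and the amalgam maps to \<open>H\<close> with
  \<open>t \<mapsto> h\<close>. Otherwise \<open>H\<close> is trivial and the amalgam retracts onto \<open>G\<^sub>i\<close>. Both contradict \<open>incl i t = 1\<close>.
\<close>

lemma incl_inj:
  assumes C: "circular_ordering K C"
    and pres: "\<And>i. i \<in> I \<Longrightarrow> circular_order_preserving (G i) (c i) C (incl i)"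
    and i: "i \<in> I"
  shows "inj_on (incl i) (carrier (G i))"
proof (rule ccontr)
  assume "\<not> ?thesis"
  have small: "carrier (G j) = {\<one>\<^bsub>G j\<^esub>, t}"
    if j: "j \<in> I" and t: "t \<in> carrier (G j)" "t \<noteq> \<one>\<^bsub>G j\<^esub>" "incl j t = \<one>\<^bsub>K\<^esub>" for j t
  proof -
    interpret Gj: circularly_ordered_group "G j" "c j" using j by (rule circ_group)
    have one: "incl j \<one>\<^bsub>G j\<^esub> = \<one>\<^bsub>K\<^esub>"
      using hom_one[OF amalgam_incl_hom[OF j] group_G[OF j] K.is_group] .
    have "w = \<one>\<^bsub>G j\<^esub> \<or> w = t" if w: "w \<in> carrier (G j)" for w
    proof -
      have "c j \<one>\<^bsub>G j\<^esub> t w = C (incl j \<one>\<^bsub>G j\<^esub>) (incl j t) (incl j w)"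
        using pres[OF j] t w Gj.one_closed unfolding circular_order_preserving_def by blast
      also have "\<dots> = 0"
        using C incl_carrier[OF j w] K.one_closed t one unfolding circular_ordering_def by metis
      finally show ?thesis using Gj.circ_zero[of "\<one>\<^bsub>G j\<^esub>" t w] t w by auto
    qed
    then show ?thesis using t by auto
  qed
  interpret ii: group_hom "G i" K "incl i"
    using i by (simp add: group_hom_def group_hom_axioms_def group_G K.is_group amalgam_incl_hom)
  interpret H: group H by (rule group_H)
  from \<open>\<not> ?thesis\<close> obtain t where t: "t \<in> carrier (G i)" "t \<noteq> \<one>\<^bsub>G i\<^esub>" "incl i t = \<one>\<^bsub>K\<^esub>"
    using ii.inj_on_one_iff by blast
  show False
  proof (cases "t \<in> \<phi> i ` carrier H")
    case True
    then obtain h where h: "h \<in> carrier H" "t = \<phi> i h" by auto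
    have h1: "h \<noteq> \<one>\<^bsub>H\<^esub>"
      using h t hom_one[OF hom_\<phi>[OF i] group_H group_G[OF i]] by auto
    have iso: "\<phi> j \<in> iso H (G j)" if j: "j \<in> I" for j
    proof -
      have p1: "\<phi> j \<one>\<^bsub>H\<^esub> = \<one>\<^bsub>G j\<^esub>" using hom_one[OF hom_\<phi>[OF j] group_H group_G[OF j]] .
      have "\<phi> j h \<noteq> \<one>\<^bsub>G j\<^esub>" using p1 h h1 inj_\<phi>[OF j] by (metis H.one_closed inj_onD)
      moreover have "incl j (\<phi> j h) = \<one>\<^bsub>K\<^esub>" using amalgam_incl_glue[OF j i h(1)] h t by simp
      moreover have "\<phi> j h \<in> carrier (G j)" using hom_in_carrier[OF hom_\<phi>[OF j] h(1)] .
      ultimately have "carrier (G j) = {\<one>\<^bsub>G j\<^esub>, \<phi> j h}" using small j by blast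
      then have "carrier (G j) = \<phi> j ` {\<one>\<^bsub>H\<^esub>, h}" using p1 by simp
      then have "\<phi> j ` carrier H = carrier (G j)"
        using h H.one_closed hom_in_carrier[OF hom_\<phi>[OF j]] by blast
      then show ?thesis using hom_\<phi>[OF j] inj_\<phi>[OF j] by (simp add: iso_def bij_betw_def)
    qed
    have back_hom: "inv_into (carrier H) (\<phi> j) \<in> hom (G j) H" if "j \<in> I" for j
      using H.iso_set_sym[OF iso[OF that]] by (simp add: iso_def)
    have retract: "inv_into (carrier H) (\<phi> j) (\<phi> j g) = g" if "j \<in> I" "g \<in> carrier H" for j g
      using inj_\<phi> that by simp
    obtain F where F: "F \<in> hom K H"
      "\<And>j x. j \<in> I \<Longrightarrow> x \<in> carrier (G j) \<Longrightarrow> F (incl j x) = inv_into (carrier H) (\<phi> j) x"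
      by (rule amalgam_universal[OF group_H back_hom]) (simp_all add: retract)
    have "F (incl i t) = h" using F(2)[OF i t(1)] h retract[OF i] by simp
    then show False using t h1 hom_one[OF F(1) K.is_group group_H] by simp
  next
    case False
    have "g = \<one>\<^bsub>H\<^esub>" if g: "g \<in> carrier H" for g
    proof -
      have "\<phi> i g \<in> {\<one>\<^bsub>G i\<^esub>, t}"
        using small[OF i t] hom_in_carrier[OF hom_\<phi>[OF i] g] by simp
      then have "\<phi> i g = \<phi> i \<one>\<^bsub>H\<^esub>"
        using False g hom_one[OF hom_\<phi>[OF i] group_H group_G[OF i]] by auto
      then show ?thesis using inj_\<phi>[OF i] g by (metis H.one_closed inj_onD)
    qed
    then have triv: "\<phi> j g = \<one>\<^bsub>G j\<^esub>" if "j \<in> I" "g \<in> carrier H" for j g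
      using hom_one[OF hom_\<phi> group_H group_G] that by metis
    let ?f = "\<lambda>j x. if j = i then x else \<one>\<^bsub>G i\<^esub>"
    have retract_hom: "?f j \<in> hom (G j) (G i)" for j by (auto intro!: homI)
    obtain F where F: "F \<in> hom K (G i)"
      "\<And>j x. j \<in> I \<Longrightarrow> x \<in> carrier (G j) \<Longrightarrow> F (incl j x) = ?f j x"
      by (rule amalgam_universal[OF group_G[OF i] retract_hom]) (auto simp: triv)
    show False using t F(2)[OF i t(1)] hom_one[OF F(1) K.is_group group_G[OF i]] by simp
  qed
qed

text \<open>
  \<open>\<psi>\<close> lies over \<open>\<pi>\<close>, so only central integers can be in its kernel, and their images \<open>(n, 1)\<close> are distinct.
\<close>

lemma left_ordering_of_circular_ordering:
  assumes C: "circular_ordering K C"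
    and pres: "\<And>i. i \<in> I \<Longrightarrow> circular_order_preserving (G i) (c i) C (incl i)"
  shows "\<exists>lt. left_ordering L.K lt \<and> (\<forall>i\<in>I. \<forall>x\<in>carrier (G' i). \<forall>y\<in>carrier (G' i).
    lt (incl' i x) (incl' i y) \<longleftrightarrow> lift_less (G i) (c i) x y)"
proof -
  interpret C: circularly_ordered_group K C
    using C by (simp add: circularly_ordered_group_def circularly_ordered_group_axioms_def K.is_group)
  note mono = lift_map_mono[OF group_G K.is_group amalgam_incl_hom incl_inj[OF C pres] pres circ_G C]
  have compat: "lift_map (incl i) (\<phi>' i h) = lift_map (incl j) (\<phi>' j h)"
    if "i \<in> I" "j \<in> I" "h \<in> carrier H'" for i j h
    using that amalgam_incl_glue[OF that(1,2), of "snd h"]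
    by (cases h) (simp add: lift_map_Pair lift_group_simps)
  obtain \<psi> where psi: "\<psi> \<in> hom L.K C.L"
    and psi_incl: "\<And>i x. i \<in> I \<Longrightarrow> x \<in> carrier (G' i) \<Longrightarrow> \<psi> (incl' i x) = lift_map (incl i) x"
  proof (rule L.amalgam_universal[OF C.lift.is_group mono(1) compat])
    fix F assume "F \<in> hom L.K C.L"
      "\<And>i x. i \<in> I \<Longrightarrow> x \<in> carrier (G' i) \<Longrightarrow> F (incl' i x) = lift_map (incl i) x"
    then show thesis by (rule that)
  qed
  interpret \<psi>: group_hom L.K C.L \<psi>
    using psi by (simp add: group_hom_def group_hom_axioms_def LK.is_group C.lift.is_group)
  obtain \<pi> where pi: "\<pi> \<in> hom L.K K"
    and pi_incl: "\<And>i n x. i \<in> I \<Longrightarrow> x \<in> carrier (G i) \<Longrightarrow> \<pi> (incl' i (n, x)) = incl i x"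
    and ker: "\<And>A. A \<in> carrier L.K \<Longrightarrow> \<pi> A = \<one>\<^bsub>K\<^esub> \<Longrightarrow> \<exists>n. A = \<zeta> n"
    by (rule projection) blast
  have psi_pi: "(snd \<circ> \<psi>) A = \<pi> A" if "A \<in> carrier L.K" for A
  proof (rule L.amalgam_hom_unique[OF K.is_group _ pi _ that])
    show "snd \<circ> \<psi> \<in> hom L.K K" using hom_compose[OF psi snd_lift_hom] .
    show "(snd \<circ> \<psi>) (incl' i x) = \<pi> (incl' i x)" if "i \<in> I" "x \<in> carrier (G' i)" for i x
      using that by (cases x) (simp add: psi_incl lift_map_Pair pi_incl lift_group_simps)
  qed
  have inj: "inj_on \<psi> (carrier L.K)"
    unfolding \<psi>.inj_on_one_iff
  proof (intro allI impI)
    fix A assume A: "A \<in> carrier L.K" "\<psi> A = \<one>\<^bsub>C.L\<^esub>"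
    then have "\<pi> A = \<one>\<^bsub>K\<^esub>" using psi_pi[OF A(1)] by (simp add: lift_group_simps)
    then obtain n where n: "A = \<zeta> n" using ker A by blast
    interpret Go: group "G i0" using base by (rule group_G)
    have "\<psi> A = lift_map (incl i0) (n, \<one>\<^bsub>G i0\<^esub>)"
      unfolding n \<zeta>_def using base by (simp add: psi_incl lift_group_simps)
    then have "n = 0" using A by (simp add: lift_map_Pair lift_group_simps)
    then show "A = \<one>\<^bsub>L.K\<^esub>"
      using n hom_one[OF zeta_hom group_integer_group LK.is_group] by simp
  qed
  define lt where "lt A B = lift_less K C (\<psi> A) (\<psi> B)" for A B
  have "left_ordering L.K lt"
  proof -
    have lo: "left_ordering C.L (lift_less K C)" by (rule C.left_ordering_lift)
    have inj': "\<psi> A = \<psi> B \<longleftrightarrow> A = B" if "A \<in> carrier L.K" "B \<in> carrier L.K" for A B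
      using inj that by (auto dest: inj_onD)
    have cl: "\<psi> A \<in> carrier C.L" if "A \<in> carrier L.K" for A using that by simp
    show ?thesis
      unfolding left_ordering_def
    proof (intro conjI)
      show "irreflp_on (carrier L.K) lt"
        using lo cl unfolding left_ordering_def irreflp_on_def lt_def by blast
      show "transp_on (carrier L.K) lt"
        using lo cl unfolding left_ordering_def transp_on_def lt_def by blast
      show "totalp_on (carrier L.K) lt"
        using lo cl inj' unfolding left_ordering_def totalp_on_def lt_def by blast
      show "\<forall>f\<in>carrier L.K. \<forall>g\<in>carrier L.K. \<forall>h\<in>carrier L.K.
          lt g h \<longrightarrow> lt (f \<otimes>\<^bsub>L.K\<^esub> g) (f \<otimes>\<^bsub>L.K\<^esub> h)"
        using lo cl unfolding left_ordering_def lt_def by simp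
    qed
  qed
  moreover have "lt (incl' i x) (incl' i y) \<longleftrightarrow> lift_less (G i) (c i) x y"
    if "i \<in> I" "x \<in> carrier (G' i)" "y \<in> carrier (G' i)" for i x y
    using that mono(2) by (simp add: lt_def psi_incl)
  ultimately show ?thesis by blast
qed

end

text \<open>
  With no factors there are no central integers to work with, and both sides of the equivalence hold trivially.
\<close>

lemma carrier_amalgam_empty:
  assumes "amalgam_data {} G H \<phi>"
  shows "carrier (amalgam {} G H \<phi>) = {\<one>\<^bsub>amalgam {} G H \<phi>\<^esub>}"
proof -
  interpret amalgam_data "{}" G H \<phi> by fact
  interpret group K by (rule group_amalgam)
  have "A = \<one>\<^bsub>K\<^esub>" if "A \<in> carrier K" for A
    using that by (induction A rule: amalgam_induct) auto
  then show ?thesis by auto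
qed

theorem theorem1:
  fixes I :: "'i set"
    and G :: "'i \<Rightarrow> 'a monoid" and c :: "'i \<Rightarrow> 'a \<Rightarrow> 'a \<Rightarrow> 'a \<Rightarrow> int"
    and Hs :: "'i \<Rightarrow> 'a set"
    and H :: "'b monoid" and d :: "'b \<Rightarrow> 'b \<Rightarrow> 'b \<Rightarrow> int"
    and \<phi> :: "'i \<Rightarrow> 'b \<Rightarrow> 'a"
  assumes "\<And>i. i \<in> I \<Longrightarrow> group (G i)"
    and "\<And>i. i \<in> I \<Longrightarrow> circular_ordering (G i) (c i)"
    and "\<And>i. i \<in> I \<Longrightarrow> subgroup (Hs i) (G i)"
    and "group H"
    and "circular_ordering H d"
    and "\<And>i. i \<in> I \<Longrightarrow> \<phi> i \<in> iso H (G i\<lparr>carrier := Hs i\<rparr>)"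
    and "\<And>i. i \<in> I \<Longrightarrow> circular_order_preserving H d (c i) (\<phi> i)"
  shows "(\<exists>C. circular_ordering (amalgam I G H \<phi>) C \<and>
            (\<forall>i\<in>I. circular_order_preserving (G i) (c i) C (amalgam_incl I G H \<phi> i)))
         \<longleftrightarrow>
         (let G' = (\<lambda>i. lift_group (G i) (c i)); H' = lift_group H d; \<phi>' = (\<lambda>i. lift_map (\<phi> i)) in
          \<exists>lt. left_ordering (amalgam I G' H' \<phi>') lt \<and>
            (\<forall>i\<in>I. \<forall>x\<in>carrier (G' i). \<forall>y\<in>carrier (G' i).
               lt (amalgam_incl I G' H' \<phi>' i x) (amalgam_incl I G' H' \<phi>' i y)
               \<longleftrightarrow> lift_less (G i) (c i) x y))"
proof (cases "I = {}")
  case True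
  let ?K = "amalgam I G H \<phi>"
  let ?L = "amalgam I (\<lambda>i. lift_group (G i) (c i)) (lift_group H d) (\<lambda>i. lift_map (\<phi> i))"
  have 1: "carrier ?K = {\<one>\<^bsub>?K\<^esub>}"
    unfolding True by (rule carrier_amalgam_empty) (simp add: amalgam_data_def \<open>group H\<close>)
  have 2: "carrier ?L = {\<one>\<^bsub>?L\<^esub>}"
    unfolding True by (rule carrier_amalgam_empty)
      (simp add: amalgam_data_def group_lift_group \<open>group H\<close> \<open>circular_ordering H d\<close>)
  have "circular_ordering ?K (\<lambda>_ _ _. 0)"
    unfolding circular_ordering_def 1 by simp
  moreover have "left_ordering ?L (\<lambda>_ _. False)"
    unfolding left_ordering_def 2
    by (simp add: irreflp_on_def transp_on_def totalp_on_def)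
  ultimately show ?thesis using True by (auto simp: Let_def)
next
  case False
  then obtain i0 where i0: "i0 \<in> I" by auto
  have \<phi>_hom: "\<phi> i \<in> hom H (G i)" and \<phi>_inj: "inj_on (\<phi> i) (carrier H)" if "i \<in> I" for i
    using assms(6)[OF that] subgroup.subset[OF assms(3)[OF that]]
    by (auto simp: iso_def hom_def bij_betw_def)
  have "amalgam_data I G H \<phi>"
    using assms(1,4) \<phi>_hom by (rule amalgam_data.intro)
  moreover have "circular_amalgam_axioms I G H \<phi> c d i0"
  proof (rule circular_amalgam_axioms.intro)
    fix i assume "i \<in> I"
    then show "circular_ordering (G i) (c i)" "inj_on (\<phi> i) (carrier H)"
      "circular_order_preserving H d (c i) (\<phi> i)"
      by (fact assms(2) \<phi>_inj assms(7))+
  qed fact+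
  ultimately interpret circular_amalgam I G H \<phi> c d i0
    by (rule circular_amalgam.intro)
  show ?thesis
    unfolding Let_def
  proof
    assume "\<exists>C. circular_ordering K C \<and> (\<forall>i\<in>I. circular_order_preserving (G i) (c i) C (incl i))"
    then obtain C where "circular_ordering K C"
      "\<And>i. i \<in> I \<Longrightarrow> circular_order_preserving (G i) (c i) C (incl i)" by blast
    then show "\<exists>lt. left_ordering L.K lt \<and> (\<forall>i\<in>I. \<forall>x\<in>carrier (G' i). \<forall>y\<in>carrier (G' i).
        lt (incl' i x) (incl' i y) \<longleftrightarrow> lift_less (G i) (c i) x y)"
      by (rule left_ordering_of_circular_ordering)
  next
    assume "\<exists>lt. left_ordering L.K lt \<and> (\<forall>i\<in>I. \<forall>x\<in>carrier (G' i). \<forall>y\<in>carrier (G' i).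
        lt (incl' i x) (incl' i y) \<longleftrightarrow> lift_less (G i) (c i) x y)"
    then obtain lt where "left_ordering L.K lt"
      "\<And>i x y. i \<in> I \<Longrightarrow> x \<in> carrier (G' i) \<Longrightarrow> y \<in> carrier (G' i) \<Longrightarrow>
        lt (incl' i x) (incl' i y) \<longleftrightarrow> lift_less (G i) (c i) x y" by blast
    then show "\<exists>C. circular_ordering K C \<and>
        (\<forall>i\<in>I. circular_order_preserving (G i) (c i) C (incl i))"
      by (rule circular_ordering_of_left_ordering)
  qed
qed

end
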